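(* Let $(\Omega,\mathcal{F},(\mathcal{F}_t)_{t\ge 0},\mathbb{P})$ be a filtered probability space satisfying property (NP), let $(X_t)_{t\ge 0}$ be a submartingale of class $(\Sigma)$ on it with decomposition $X_t=N_t+A_t$, and let $\mathcal{Q}$ be the associated $\sigma$-finite measure. Suppose that $A_\infty=\infty$, $\mathbb{P}$-almost surely. Let $(F_t)_{t\ge0}$ be a càdlàg, adapted, nonnegative process such that its limit $F_\infty=\lim_{t\to\infty}F_t$ exists $\mathcal{Q}$-almost everywhere and is not $\mathcal{Q}$-almost everywhere equal to zero. Suppose that there exists a $\mathcal{Q}$-integrable, nonnegative functional $H$ such that for all $t\ge0$, $$F_tX_t\le M_t(H)\qquad \mathbb{P}\text{-almost surely}.$$ Then, for $t$ sufficiently large, $0<\mathbb{P}[F_tX_t]<\infty$, and one can define a measure $\mathbb{Q}_t$ by $$\mathbb{Q}_t=\frac{F_tX_t}{\mathbb{P}[F_tX_t]}\,.\,\mathbb{P}.$$ Moreover, there exists a probability measure $\mathbb{Q}_\infty$ on $(\Omega,\mathcal{F})$ such that for all $s\ge0$ and all events $\Lambda_s\in\mathcal{F}_s$, $$\mathbb{Q}_t[\Lambda_s]\underset{t\to\infty}{\longrightarrow}\mathbb{Q}_\infty[\Lambda_s].$$ The measure $\mathbb{Q}_\infty$ is absolutely continuous with respect to $\mathcal{Q}$: $$\mathbb{Q}_\infty=\frac{F_\infty}{\mathcal{Q}[F_\infty]}\,.\,\mathcal{Q},$$ where $0<\mathcal{Q}[F_\infty]<\infty$.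
   Context: Notation: $\mathbb{P}[Y]$ denotes the expectation of $Y$ under $\mathbb{P}$ (and $\mathcal{Q}[Y]$ the integral of $Y$ under $\mathcal{Q}$); $F.\mu$ denotes the measure with density $F$ with respect to $\mu$; for an increasing process $(A_t)$, $A_\infty=\lim_{t\to\infty}A_t$. Class $(\Sigma)$: a nonnegative submartingale $(X_t)_{t\ge0}$ is of class $(\Sigma)$ iff $X_t=N_t+A_t$ where $(N_t)$ and $(A_t)$ are adapted, $(N_t)$ is a càdlàg martingale, $(A_t)$ is a continuous increasing process with $A_0=0$, and the measure $(dA_t)$ is carried by $\{t\ge0: X_t=0\}$. (In particular $X_t$ is integrable for all $t$.) Natural conditions: $(\Omega,\mathcal{F},(\mathcal{F}_t),\mathbb{P})$ satisfies the natural conditions iff $(\mathcal{F}_t)$ is right-continuous and, for all $t\ge0$ and every $\mathbb{P}$-negligible $A\in\mathcal{F}_t$, all subsets of $A$ belong to $\mathcal{F}_0$. The natural enlargement of a filtered probability space is its smallest extension (same $\Omega$, larger $\sigma$-algebras, extended probability) satisfying the natural conditions; it exists and is unique. Property (P): a filtered measurable space $(\Omega,\mathcal{F},(\mathcal{F}_t))$ with $\mathcal{F}=\bigvee_{t\ge0}\mathcal{F}_t$ satisfies (P) iff (i) each $\mathcal{F}_t$ is countably generated; (ii) for each $t$ there are a Polish space $\Omega_t$ and a surjection $\pi_t:\Omega\to\Omega_t$ such that $\mathcal{F}_t$ is the $\sigma$-algebra of inverse images under $\pi_t$ of Borel sets of $\Omega_t$, and for all $B\in\mathcal{F}_t$,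 $\omega\in\Omega$, $\pi_t(\omega)\in\pi_t(B)$ implies $\omega\in B$; (iii) if $(\omega_n)_{n\ge0}$ is a sequence in $\Omega$ with $\bigcap_{n=0}^N A_n(\omega_n)\ne\emptyset$ for all $N\ge0$, where $A_n(\omega_n)$ is the intersection of the sets of $\mathcal{F}_n$ containing $\omega_n$, then $\bigcap_{n=0}^\infty A_n(\omega_n)\neq\emptyset$. Property (NP): a filtered probability space satisfies (NP) iff it is the natural enlargement of a filtered probability space $(\Omega,\mathcal{F}^0,(\mathcal{F}^0_t),\mathbb{P}^0)$ such that $(\Omega,\mathcal{F}^0,(\mathcal{F}^0_t))$ satisfies (P). In this case $\mathcal{F}=\bigvee_{t\ge 0}\mathcal{F}_t$. The measure $\mathcal{Q}$ (known theorem): if $(X_t)$ is a submartingale of class $(\Sigma)$ on a space satisfying (NP) and $g:=\sup\{t\ge0: X_t=0\}$ (with $\sup\emptyset=0$), there is a unique $\sigma$-finite measure $\mathcal{Q}$ on $(\Omega,\mathcal{F})$ such that $\mathcal{Q}[g=\infty]=0$ and, for all $t\ge0$ and all bounded $\mathcal{F}_t$-measurable $F_t$, $\mathcal{Q}[F_t\mathds{1}_{g\le t}]=\mathbb{P}[F_tX_t]$. The martingale $M_t(F)$: for a nonnegative, $\mathcal{Q}$-integrable functional $F$ on $(\Omega,\mathcal{F})$, $(M_t(F))_{t\ge0}$ denotes the càdlàg $\mathbb{P}$-martingale, unique up to indistinguishability, such that $\mathcal{Q}[F\,\Gamma_t]=\mathbb{P}[\Gamma_tM_t(F)]$ for all $t\ge0$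 and all bounded $\mathcal{F}_t$-measurable $\Gamma_t$. *)

theory Defs
  imports "HOL-Probability.Probability"
begin

section \<open>Filtered spaces\<close>

text \<open>
  Time is the half-line \<open>[0, \<infinity>)\<close>. Filtrations and processes are indexed by \<^typ>\<open>real\<close>, and only
  the indices \<open>t \<ge> 0\<close> are ever constrained or used.
\<close>

definition filtered_measurable_space :: "'a measure \<Rightarrow> (real \<Rightarrow> 'a measure) \<Rightarrow> bool" where
  "filtered_measurable_space M \<F> \<longleftrightarrow>
     (\<forall>t\<ge>0. subalgebra M (\<F> t)) \<and>
     (\<forall>s t. 0 \<le> s \<and> s \<le> t \<longrightarrow> subalgebra (\<F> t) (\<F> s))"

definition filtered_prob_space :: "'a measure \<Rightarrow> (real \<Rightarrow> 'a measure) \<Rightarrow> bool" where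
  "filtered_prob_space P \<F> \<longleftrightarrow> prob_space P \<and> filtered_measurable_space P \<F>"

definition natural_conditions :: "'a measure \<Rightarrow> (real \<Rightarrow> 'a measure) \<Rightarrow> bool" where
  "natural_conditions P \<F> \<longleftrightarrow>
     (\<forall>t\<ge>0. sets (\<F> t) = (\<Inter>s\<in>{t<..}. sets (\<F> s))) \<and>
     (\<forall>t\<ge>0. \<forall>A\<in>sets (\<F> t). emeasure P A = 0 \<longrightarrow> (\<forall>B. B \<subseteq> A \<longrightarrow> B \<in> sets (\<F> 0)))"

definition extends_to ::
  "'a measure \<Rightarrow> (real \<Rightarrow> 'a measure) \<Rightarrow> 'a measure \<Rightarrow> (real \<Rightarrow> 'a measure) \<Rightarrow> bool" where
  "extends_to P \<F> P' \<F>' \<longleftrightarrow>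
     space P' = space P \<and> sets P \<subseteq> sets P' \<and>
     (\<forall>t\<ge>0. sets (\<F> t) \<subseteq> sets (\<F>' t)) \<and>
     (\<forall>A\<in>sets P. emeasure P' A = emeasure P A)"

definition natural_enlargement ::
  "'a measure \<Rightarrow> (real \<Rightarrow> 'a measure) \<Rightarrow> 'a measure \<Rightarrow> (real \<Rightarrow> 'a measure) \<Rightarrow> bool" where
  "natural_enlargement P0 \<F>0 P \<F> \<longleftrightarrow>
     filtered_prob_space P \<F> \<and> natural_conditions P \<F> \<and> extends_to P0 \<F>0 P \<F> \<and>
     (\<forall>P' \<F>'. filtered_prob_space P' \<F>' \<and> natural_conditions P' \<F>' \<and> extends_to P0 \<F>0 P' \<F>'
        \<longrightarrow> extends_to P \<F> P' \<F>')"

definition polish_topology :: "'b topology \<Rightarrow> bool" where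
  "polish_topology Y \<longleftrightarrow> completely_metrizable_space Y \<and> separable_space Y"

definition atom_at :: "'a measure \<Rightarrow> 'a \<Rightarrow> 'a set" where
  "atom_at G \<omega> = \<Inter>{B \<in> sets G. \<omega> \<in> B}"

text \<open>
  In the definition below only the \<open>\<sigma>\<close>-algebra of \<open>M\<close> matters, not its measure. In the third clause
  the Polish space is taken with points in the type of \<open>\<Omega>\<close>. This is no restriction: it is a
  surjective image of \<open>\<Omega>\<close>, so a section of the surjection transports it onto a subset of \<open>\<Omega>\<close>.
\<close>

definition property_P :: "'a measure \<Rightarrow> (real \<Rightarrow> 'a measure) \<Rightarrow> bool" where
  "property_P M \<F> \<longleftrightarrow>
     filtered_measurable_space M \<F> \<and>
     sets M = sigma_sets (space M) (\<Union>t\<in>{0..}. sets (\<F> t)) \<and>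
     (\<forall>t\<ge>0. \<exists>C. countable C \<and> C \<subseteq> Pow (space M) \<and> sets (\<F> t) = sigma_sets (space M) C) \<and>
     (\<forall>t\<ge>0. \<exists>(Y :: 'a topology) \<pi>. polish_topology Y \<and> \<pi> ` space M = topspace Y \<and>
        sets (\<F> t) = {\<pi> -` B \<inter> space M | B. B \<in> sigma_sets (topspace Y) {U. openin Y U}} \<and>
        (\<forall>B\<in>sets (\<F> t). \<forall>\<omega>\<in>space M. \<pi> \<omega> \<in> \<pi> ` B \<longrightarrow> \<omega> \<in> B)) \<and>
     (\<forall>w :: nat \<Rightarrow> 'a. (\<forall>n. w n \<in> space M) \<and>
        (\<forall>k. (\<Inter>n\<le>k. atom_at (\<F> (real n)) (w n)) \<noteq> {})
        \<longrightarrow> (\<Inter>n. atom_at (\<F> (real n)) (w n)) \<noteq> {})"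

definition property_NP :: "'a measure \<Rightarrow> (real \<Rightarrow> 'a measure) \<Rightarrow> bool" where
  "property_NP P \<F> \<longleftrightarrow>
     (\<exists>P0 \<F>0. filtered_prob_space P0 \<F>0 \<and> property_P P0 \<F>0 \<and> natural_enlargement P0 \<F>0 P \<F>)"

section \<open>Processes\<close>

text \<open>
  Path properties (continuity, monotonicity, being cadlag, ...) are required for every \<open>\<omega> \<in> \<Omega>\<close>, not
  just \<open>P\<close>-almost surely: under the natural conditions \<open>P\<close>-null sets of the terminal \<open>\<sigma>\<close>-algebra
  may be charged by the measure \<open>Q\<close> below, so they cannot be discarded.
\<close>

definition adapted :: "(real \<Rightarrow> 'a measure) \<Rightarrow> (real \<Rightarrow> 'a \<Rightarrow> real) \<Rightarrow> bool" where
  "adapted \<F> X \<longleftrightarrow> (\<forall>t\<ge>0. X t \<in> borel_measurable (\<F> t))"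

definition cadlag :: "(real \<Rightarrow> real) \<Rightarrow> bool" where
  "cadlag f \<longleftrightarrow> (\<forall>t\<ge>0. (f \<longlongrightarrow> f t) (at_right t)) \<and> (\<forall>t>0. \<exists>l. (f \<longlongrightarrow> l) (at_left t))"

definition cadlag_process :: "'a measure \<Rightarrow> (real \<Rightarrow> 'a \<Rightarrow> real) \<Rightarrow> bool" where
  "cadlag_process P X \<longleftrightarrow> (\<forall>\<omega>\<in>space P. cadlag (\<lambda>t. X t \<omega>))"

definition martingale :: "'a measure \<Rightarrow> (real \<Rightarrow> 'a measure) \<Rightarrow> (real \<Rightarrow> 'a \<Rightarrow> real) \<Rightarrow> bool" where
  "martingale P \<F> M \<longleftrightarrow> adapted \<F> M \<and> (\<forall>t\<ge>0. integrable P (M t)) \<and>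
     (\<forall>s t. 0 \<le> s \<and> s \<le> t \<longrightarrow> (AE \<omega> in P. real_cond_exp P (\<F> s) (M t) \<omega> = M s \<omega>))"

definition submartingale :: "'a measure \<Rightarrow> (real \<Rightarrow> 'a measure) \<Rightarrow> (real \<Rightarrow> 'a \<Rightarrow> real) \<Rightarrow> bool" where
  "submartingale P \<F> X \<longleftrightarrow> adapted \<F> X \<and> (\<forall>t\<ge>0. integrable P (X t)) \<and>
     (\<forall>s t. 0 \<le> s \<and> s \<le> t \<longrightarrow> (AE \<omega> in P. X s \<omega> \<le> real_cond_exp P (\<F> s) (X t) \<omega>))"

text \<open>
  The Stieltjes measure \<open>dA\<^sub>t(\<omega>)\<close> on \<open>[0, \<infinity>)\<close> is obtained from \<^const>\<open>interval_measure\<close>, which needs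
  a function on the whole line, by extending the path by \<open>A\<^sub>0(\<omega>) = 0\<close> to negative times.
\<close>

definition class_Sigma ::
  "'a measure \<Rightarrow> (real \<Rightarrow> 'a measure) \<Rightarrow> (real \<Rightarrow> 'a \<Rightarrow> real) \<Rightarrow>
     (real \<Rightarrow> 'a \<Rightarrow> real) \<Rightarrow> (real \<Rightarrow> 'a \<Rightarrow> real) \<Rightarrow> bool" where
  "class_Sigma P \<F> X N A \<longleftrightarrow>
     submartingale P \<F> X \<and>
     (\<forall>t\<ge>0. \<forall>\<omega>\<in>space P. 0 \<le> X t \<omega>) \<and>
     (\<forall>t\<ge>0. \<forall>\<omega>\<in>space P. X t \<omega> = N t \<omega> + A t \<omega>) \<and>
     martingale P \<F> N \<and> cadlag_process P N \<and>
     adapted \<F> A \<and>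
     (\<forall>\<omega>\<in>space P. continuous_on {0..} (\<lambda>t. A t \<omega>) \<and> mono_on {0..} (\<lambda>t. A t \<omega>) \<and> A 0 \<omega> = 0) \<and>
     (\<forall>\<omega>\<in>space P. {t. 0 \<le> t \<and> X t \<omega> \<noteq> 0} \<in> null_sets (interval_measure (\<lambda>t. A (max 0 t) \<omega>)))"

text \<open>The supremum is taken in \<open>[0, \<infinity>]\<close>, where \<open>sup \<emptyset> = 0\<close>.\<close>

definition last_zero :: "(real \<Rightarrow> 'a \<Rightarrow> real) \<Rightarrow> 'a \<Rightarrow> ennreal" where
  "last_zero X \<omega> = (SUP t\<in>{t. 0 \<le> t \<and> X t \<omega> = 0}. ennreal t)"

definition bounded_measurable :: "'a measure \<Rightarrow> ('a \<Rightarrow> real) \<Rightarrow> bool" where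
  "bounded_measurable G f \<longleftrightarrow> f \<in> borel_measurable G \<and> bounded (f ` space G)"

text \<open>
  \<^const>\<open>null_sets\<close> and \<^const>\<open>has_bochner_integral\<close> include the measurability and integrability
  without which \<open>Q[g = \<infinity>]\<close> and \<open>Q[F\<^sub>t 1(g \<le> t)]\<close> would be meaningless.
\<close>

definition associated_measure ::
  "'a measure \<Rightarrow> (real \<Rightarrow> 'a measure) \<Rightarrow> (real \<Rightarrow> 'a \<Rightarrow> real) \<Rightarrow> 'a measure \<Rightarrow> bool" where
  "associated_measure P \<F> X Q \<longleftrightarrow>
     space Q = space P \<and> sets Q = sets P \<and> sigma_finite_measure Q \<and>
     {\<omega>\<in>space Q. last_zero X \<omega> = \<infinity>} \<in> null_sets Q \<and>
     (\<forall>t\<ge>0. \<forall>f. bounded_measurable (\<F> t) f \<longrightarrow>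
        has_bochner_integral Q (\<lambda>\<omega>. f \<omega> * indicator {\<omega>. last_zero X \<omega> \<le> ennreal t} \<omega>)
          (\<integral>\<omega>. f \<omega> * X t \<omega> \<partial>P))"

text \<open>\<open>M\<close> is a version of the process \<open>(M\<^sub>t(H))\<close>, which is determined up to indistinguishability.\<close>

definition associated_martingale ::
  "'a measure \<Rightarrow> (real \<Rightarrow> 'a measure) \<Rightarrow> 'a measure \<Rightarrow> ('a \<Rightarrow> real) \<Rightarrow> (real \<Rightarrow> 'a \<Rightarrow> real) \<Rightarrow> bool" where
  "associated_martingale P \<F> Q H M \<longleftrightarrow>
     martingale P \<F> M \<and> cadlag_process P M \<and>
     (\<forall>t\<ge>0. \<forall>\<Gamma>. bounded_measurable (\<F> t) \<Gamma> \<longrightarrow>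
        (\<integral>\<omega>. H \<omega> * \<Gamma> \<omega> \<partial>Q) = (\<integral>\<omega>. \<Gamma> \<omega> * M t \<omega> \<partial>P))"

text \<open>
  The limit is taken in \<open>[0, \<infinity>]\<close>. Where it does not exist, \<^const>\<open>Lim\<close> returns one fixed value that
  does not depend on \<open>\<omega>\<close>.
\<close>

definition limit_functional :: "(real \<Rightarrow> 'a \<Rightarrow> real) \<Rightarrow> 'a \<Rightarrow> ennreal" where
  "limit_functional F \<omega> = Lim at_top (\<lambda>t. ennreal (F t \<omega>))"

end

theory Submission
  imports Defs
begin

text \<open>
  Let \<open>g\<close> be the last zero of \<open>X\<close>. By the characterisation of \<open>Q\<close>, \<open>P[F\<^sub>t X\<^sub>t 1\<^sub>\<Lambda>]\<close> equals
  \<open>Q[F\<^sub>t 1\<^sub>\<Lambda> 1(g \<le> t)]\<close>, whose integrand converges \<open>Q\<close>-almost everywhere to \<open>F\<^sub>\<infinity> 1\<^sub>\<Lambda>\<close>; only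
  uniform integrability is missing. Up to \<open>Q\<close>-null sets the event \<open>g \<le> n\<close> agrees on \<open>g \<le> t\<close> with an
  event of \<open>\<F>\<^sub>t\<close>, for \<open>t \<ge> n\<close>. Testing \<open>F\<^sub>t X\<^sub>t \<le> M\<^sub>t(H)\<close> on the event that \<open>M\<^sub>t(H)\<close> exceeds
  \<open>n 1(g \<le> n) X\<^sub>t\<close> therefore gives
  \<open>Q[(F\<^sub>t 1(g \<le> t) - n 1(g \<le> n))\<^sup>+] \<le> Q[(H - n 1(g \<le> n))\<^sup>+]\<close>. The right-hand side does not depend
  on \<open>t\<close> and tends to \<open>0\<close>, while \<open>n 1(g \<le> n)\<close> is \<open>Q\<close>-integrable, so dominated convergence applies
  up to an arbitrarily small error.
\<close>

section \<open>Convergence of integrals under domination up to a small excess\<close>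

lemma min_add_diff_ennreal: "min a b + (a - b) = (a :: ennreal)"
  by (cases a b rule: ennreal2_cases)
    (auto simp: min_def ennreal_minus ennreal_neg simp flip: ennreal_plus)

text \<open>Fatou bounds the integral of \<open>f\<close> by the liminf. For the limsup,
  \<open>u i\<close> is cut at level \<open>K n\<close>: the part below converges by dominated
  convergence, the part above costs at most \<open>e n\<close>, and \<open>n\<close> is sent to
  infinity last. The bound on the excess may start at an index that depends on
  \<open>n\<close>.\<close>

lemma almost_dominated_convergence:
  fixes u :: "nat \<Rightarrow> 'a \<Rightarrow> ennreal" and K :: "nat \<Rightarrow> 'a \<Rightarrow> ennreal"
  assumes [measurable]: "\<And>i. u i \<in> borel_measurable M" "f \<in> borel_measurable M"
      "\<And>n. K n \<in> borel_measurable M"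
    and lim: "AE x in M. (\<lambda>i. u i x) \<longlonglongrightarrow> f x"
    and K: "\<And>n. (\<integral>\<^sup>+x. K n x \<partial>M) < \<infinity>"
    and excess: "\<And>n. \<forall>\<^sub>F i in sequentially. (\<integral>\<^sup>+x. u i x - K n x \<partial>M) \<le> e n"
    and e: "e \<longlonglongrightarrow> 0"
  shows "(\<integral>\<^sup>+x. f x \<partial>M) < \<infinity>" "(\<lambda>i. \<integral>\<^sup>+x. u i x \<partial>M) \<longlonglongrightarrow> (\<integral>\<^sup>+x. f x \<partial>M)"
proof -
  have "(\<integral>\<^sup>+x. f x \<partial>M) = (\<integral>\<^sup>+x. liminf (\<lambda>i. u i x) \<partial>M)"
    using lim by (intro nn_integral_cong_AE) (auto elim!: eventually_mono simp: lim_imp_Liminf)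
  also have "\<dots> \<le> liminf (\<lambda>i. \<integral>\<^sup>+x. u i x \<partial>M)"
    by (rule nn_integral_liminf) measurable
  finally have lower: "(\<integral>\<^sup>+x. f x \<partial>M) \<le> liminf (\<lambda>i. \<integral>\<^sup>+x. u i x \<partial>M)" .
  have ls: "limsup (\<lambda>i. \<integral>\<^sup>+x. u i x \<partial>M) \<le> (\<integral>\<^sup>+x. min (f x) (K n x) \<partial>M) + e n" for n
  proof -
    have "(\<lambda>i. \<integral>\<^sup>+x. min (u i x) (K n x) \<partial>M) \<longlonglongrightarrow> (\<integral>\<^sup>+x. min (f x) (K n x) \<partial>M)"
    proof (rule nn_integral_dominated_convergence[where w="K n"])
      show "AE x in M. (\<lambda>i. min (u i x) (K n x)) \<longlonglongrightarrow> min (f x) (K n x)"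
        using lim by eventually_elim (intro tendsto_min tendsto_const)
    qed (use K in auto)
    then have *: "(\<lambda>i. (\<integral>\<^sup>+x. min (u i x) (K n x) \<partial>M) + e n) \<longlonglongrightarrow> (\<integral>\<^sup>+x. min (f x) (K n x) \<partial>M) + e n"
      by (intro tendsto_add tendsto_const)
    have "limsup (\<lambda>i. \<integral>\<^sup>+x. u i x \<partial>M) \<le> limsup (\<lambda>i. (\<integral>\<^sup>+x. min (u i x) (K n x) \<partial>M) + e n)"
    proof (rule Limsup_mono, use excess[of n] in eventually_elim)
      fix i assume "(\<integral>\<^sup>+x. u i x - K n x \<partial>M) \<le> e n"
      have "(\<integral>\<^sup>+x. u i x \<partial>M) = (\<integral>\<^sup>+x. min (u i x) (K n x) + (u i x - K n x) \<partial>M)"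
        by (simp add: min_add_diff_ennreal)
      also have "\<dots> = (\<integral>\<^sup>+x. min (u i x) (K n x) \<partial>M) + (\<integral>\<^sup>+x. u i x - K n x \<partial>M)"
        by (rule nn_integral_add) measurable
      finally show "(\<integral>\<^sup>+x. u i x \<partial>M) \<le> (\<integral>\<^sup>+x. min (u i x) (K n x) \<partial>M) + e n"
        using \<open>(\<integral>\<^sup>+x. u i x - K n x \<partial>M) \<le> e n\<close> by (simp add: add_left_mono)
    qed
    also have "\<dots> = (\<integral>\<^sup>+x. min (f x) (K n x) \<partial>M) + e n"
      using * by (intro lim_imp_Limsup) auto
    finally show ?thesis .
  qed
  have lele: "liminf (\<lambda>i. \<integral>\<^sup>+x. u i x \<partial>M) \<le> limsup (\<lambda>i. \<integral>\<^sup>+x. u i x \<partial>M)"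
    by (simp add: Liminf_le_Limsup)
  \<comment> \<open>One \<open>n\<close> with finite \<open>e n\<close> suffices for finiteness: the
    integral of \<open>f\<close> is at most that of \<open>K n\<close> plus
    \<open>e n\<close>.\<close>
  have "\<forall>\<^sub>F n in sequentially. e n < \<infinity>"
    using e by (rule order_tendstoD) simp
  then obtain n where n: "e n < \<infinity>"
    by (auto dest: eventually_happens)
  have "(\<integral>\<^sup>+x. min (f x) (K n x) \<partial>M) \<le> (\<integral>\<^sup>+x. K n x \<partial>M)"
    by (intro nn_integral_mono) auto
  then show fin: "(\<integral>\<^sup>+x. f x \<partial>M) < \<infinity>"
    using order_trans[OF lower order_trans[OF lele ls[of n]]] n K[of n]
    by (auto intro: le_less_trans simp: ennreal_add_less_top)
  have "limsup (\<lambda>i. \<integral>\<^sup>+x. u i x \<partial>M) \<le> (\<integral>\<^sup>+x. f x \<partial>M) + e n" for n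
    by (rule order_trans[OF ls[of n]]) (intro add_right_mono nn_integral_mono, auto)
  moreover have "(\<lambda>n. (\<integral>\<^sup>+x. f x \<partial>M) + e n) \<longlonglongrightarrow> (\<integral>\<^sup>+x. f x \<partial>M) + 0"
    by (intro tendsto_add tendsto_const e)
  ultimately have "limsup (\<lambda>i. \<integral>\<^sup>+x. u i x \<partial>M) \<le> (\<integral>\<^sup>+x. f x \<partial>M) + 0"
    by (intro tendsto_lowerbound[where F=sequentially]) auto
  then show "(\<lambda>i. \<integral>\<^sup>+x. u i x \<partial>M) \<longlonglongrightarrow> (\<integral>\<^sup>+x. f x \<partial>M)"
    using lower lele by (intro Liminf_eq_Limsup) auto
qed

section \<open>Limits of cadlag paths along rational times\<close>

text \<open>Right-continuity makes \<open>f t\<close> a limit of values at rationals just above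
  \<open>t\<close>, all of them in \<open>{a..}\<close>. If \<open>f t\<close> escaped the rational
  supremum or infimum, so would one of these values.\<close>

lemma cadlag_between_rational_INF_SUP:
  fixes f :: "real \<Rightarrow> real"
  assumes f: "cadlag f" and t: "0 \<le> t" "a \<le> t"
  shows "ennreal (f t) \<le> (SUP q\<in>\<rat> \<inter> {a..}. ennreal (f q))"
    and "(INF q\<in>\<rat> \<inter> {a..}. ennreal (f q)) \<le> ennreal (f t)"
proof -
  have lim: "((\<lambda>q. ennreal (f q)) \<longlongrightarrow> ennreal (f t)) (at_right t)"
    using f t by (auto simp: cadlag_def)
  have ex: "\<exists>q\<in>\<rat> \<inter> {a..}. R q" if R: "\<forall>\<^sub>F q in at_right t. R q" for R
  proof -
    obtain b where b: "t < b" "\<And>q. t < q \<Longrightarrow> q < b \<Longrightarrow> R q"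
      using R by (auto simp: eventually_at_right_field)
    obtain q where "q \<in> \<rat>" "t < q" "q < b" using Rats_dense_in_real[OF b(1)] by blast
    with b(2) t show ?thesis by (intro bexI[of _ q]) auto
  qed
  show "ennreal (f t) \<le> (SUP q\<in>\<rat> \<inter> {a..}. ennreal (f q))"
  proof (rule ccontr)
    assume "\<not> ?thesis"
    then have "\<forall>\<^sub>F q in at_right t. (SUP q\<in>\<rat> \<inter> {a..}. ennreal (f q)) < ennreal (f q)"
      by (intro order_tendstoD(1)[OF lim]) simp
    then obtain q where q: "q \<in> \<rat> \<inter> {a..}" "(SUP q\<in>\<rat> \<inter> {a..}. ennreal (f q)) < ennreal (f q)"
      by (blast dest: ex)
    have "ennreal (f q) \<le> (SUP q\<in>\<rat> \<inter> {a..}. ennreal (f q))" by (rule SUP_upper[OF q(1)])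
    with q(2) show False by simp
  qed
  show "(INF q\<in>\<rat> \<inter> {a..}. ennreal (f q)) \<le> ennreal (f t)"
  proof (rule ccontr)
    assume "\<not> ?thesis"
    then have "\<forall>\<^sub>F q in at_right t. ennreal (f q) < (INF q\<in>\<rat> \<inter> {a..}. ennreal (f q))"
      by (intro order_tendstoD(2)[OF lim]) simp
    then obtain q where q: "q \<in> \<rat> \<inter> {a..}" "ennreal (f q) < (INF q\<in>\<rat> \<inter> {a..}. ennreal (f q))"
      by (blast dest: ex)
    have "(INF q\<in>\<rat> \<inter> {a..}. ennreal (f q)) \<le> ennreal (f q)" by (rule INF_lower[OF q(1)])
    with q(2) show False by simp
  qed
qed

text \<open>\<open>L\<close> and \<open>U\<close> are the lower and upper limits at infinity taken
  over rational times; the bounds above make them control the path at all real times. Existence of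
  the limit thus becomes a condition on countably many values.\<close>

lemma cadlag_tendsto_iff_rational:
  fixes f :: "real \<Rightarrow> real"
  defines "L \<equiv> SUP n. INF q\<in>\<rat> \<inter> {real n..}. ennreal (f q)"
    and "U \<equiv> INF n. SUP q\<in>\<rat> \<inter> {real n..}. ennreal (f q)"
  assumes f: "cadlag f"
  shows "((\<lambda>t. ennreal (f t)) \<longlongrightarrow> l) at_top \<longleftrightarrow> L = l \<and> U = l"
proof
  assume lim: "((\<lambda>t. ennreal (f t)) \<longlongrightarrow> l) at_top"
  have "(INF q\<in>\<rat> \<inter> {real n..}. ennreal (f q)) \<le> l" for n
  proof (rule tendsto_lowerbound[OF lim])
    show "\<forall>\<^sub>F t in at_top. (INF q\<in>\<rat> \<inter> {real n..}. ennreal (f q)) \<le> ennreal (f t)"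
      using eventually_ge_at_top[of "real n"]
      by eventually_elim (intro cadlag_between_rational_INF_SUP f, auto)
  qed simp
  then have "L \<le> l" unfolding L_def by (intro SUP_least)
  moreover have "l \<le> (SUP q\<in>\<rat> \<inter> {real n..}. ennreal (f q))" for n
  proof (rule tendsto_upperbound[OF lim])
    show "\<forall>\<^sub>F t in at_top. ennreal (f t) \<le> (SUP q\<in>\<rat> \<inter> {real n..}. ennreal (f q))"
      using eventually_ge_at_top[of "real n"]
      by eventually_elim (intro cadlag_between_rational_INF_SUP f, auto)
  qed simp
  then have "l \<le> U" unfolding U_def by (intro INF_greatest)
  moreover have "l \<le> L"
  proof (rule dense_le)
    fix y assume "y < l"
    then have "\<forall>\<^sub>F t in at_top. y < ennreal (f t)" by (rule order_tendstoD(1)[OF lim])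
    then obtain b where b: "\<And>t. b \<le> t \<Longrightarrow> y < ennreal (f t)" by (auto simp: eventually_at_top_linorder)
    obtain n where n: "b \<le> real n" using real_arch_simple by blast
    have "y \<le> (INF q\<in>\<rat> \<inter> {real n..}. ennreal (f q))"
      by (rule INF_greatest) (use b n in \<open>auto intro: less_imp_le\<close>)
    also have "\<dots> \<le> L" unfolding L_def by (rule SUP_upper) simp
    finally show "y \<le> L" .
  qed
  moreover have "U \<le> l"
  proof (rule dense_ge)
    fix y assume "l < y"
    then have "\<forall>\<^sub>F t in at_top. ennreal (f t) < y" by (rule order_tendstoD(2)[OF lim])
    then obtain b where b: "\<And>t. b \<le> t \<Longrightarrow> ennreal (f t) < y" by (auto simp: eventually_at_top_linorder)
    obtain n where n: "b \<le> real n" using real_arch_simple by blast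
    have "U \<le> (SUP q\<in>\<rat> \<inter> {real n..}. ennreal (f q))" unfolding U_def by (rule INF_lower) simp
    also have "\<dots> \<le> y" by (rule SUP_least) (use b n in \<open>auto intro: less_imp_le\<close>)
    finally show "U \<le> y" .
  qed
  ultimately show "L = l \<and> U = l" by auto
next
  assume l: "L = l \<and> U = l"
  show "((\<lambda>t. ennreal (f t)) \<longlongrightarrow> l) at_top"
  proof (rule order_tendstoI)
    fix a assume "a < l"
    then have "a < L" using l by simp
    then obtain n :: nat where n: "a < (INF q\<in>\<rat> \<inter> {real n..}. ennreal (f q))"
      unfolding L_def less_SUP_iff by auto
    show "\<forall>\<^sub>F t in at_top. a < ennreal (f t)"
      using eventually_ge_at_top[of "real n"]
    proof eventually_elim
      case (elim t)
      have "(INF q\<in>\<rat> \<inter> {real n..}. ennreal (f q)) \<le> ennreal (f t)"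
        by (rule cadlag_between_rational_INF_SUP[OF f]) (use elim in auto)
      with n show ?case by (rule less_le_trans)
    qed
  next
    fix a assume "l < a"
    then have "U < a" using l by simp
    then obtain n :: nat where n: "(SUP q\<in>\<rat> \<inter> {real n..}. ennreal (f q)) < a"
      unfolding U_def INF_less_iff by auto
    show "\<forall>\<^sub>F t in at_top. ennreal (f t) < a"
      using eventually_ge_at_top[of "real n"]
    proof eventually_elim
      case (elim t)
      have "ennreal (f t) \<le> (SUP q\<in>\<rat> \<inter> {real n..}. ennreal (f q))"
        by (rule cadlag_between_rational_INF_SUP[OF f]) (use elim in auto)
      then show ?case using n by (rule le_less_trans)
    qed
  qed
qed

text \<open>The lower and upper limits are countable suprema and infima of measurable functions. The
  functional equals the lower limit where the two agree and is constant on the rest of the space, so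
  it is measurable itself, not only after a change on a null set.\<close>

lemma limit_functional_measurable:
  assumes F: "cadlag_process M F" and meas: "\<And>t. 0 \<le> t \<Longrightarrow> F t \<in> borel_measurable M"
  shows "limit_functional F \<in> borel_measurable M"
proof -
  define L where "L \<omega> = (SUP n. INF q\<in>\<rat> \<inter> {real n..}. ennreal (F q \<omega>))" for \<omega>
  define U where "U \<omega> = (INF n. SUP q\<in>\<rat> \<inter> {real n..}. ennreal (F q \<omega>))" for \<omega>
  have [simp]: "countable (\<rat> \<inter> {a..} :: real set)" for a
    using countable_rat by (rule countable_subset[rotated]) auto
  have Fq [measurable]: "(\<lambda>\<omega>. ennreal (F q \<omega>)) \<in> borel_measurable M"
    if "q \<in> \<rat> \<inter> {real n..}" for q n
    using meas[of q] that by (auto intro: order_trans[of 0 "real n"])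
  have L [measurable]: "L \<in> borel_measurable M"
    unfolding L_def by (intro borel_measurable_SUP borel_measurable_INF Fq) auto
  have U [measurable]: "U \<in> borel_measurable M"
    unfolding U_def by (intro borel_measurable_SUP borel_measurable_INF Fq) auto
  \<comment> \<open>Where there is no limit, \<^const>\<open>Lim\<close> is a definite description of an empty predicate.\<close>
  have "limit_functional F \<omega> = (if L \<omega> = U \<omega> then L \<omega> else (THE l. False))" if "\<omega> \<in> space M" for \<omega>
  proof -
    have "cadlag (\<lambda>t. F t \<omega>)" using F that by (simp add: cadlag_process_def)
    note iff = cadlag_tendsto_iff_rational[OF this, folded L_def U_def]
    show ?thesis
    proof (cases "L \<omega> = U \<omega>")
      case True
      then show ?thesis
        unfolding limit_functional_def by (simp add: tendsto_Lim iff)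
    next
      case False
      then have "((\<lambda>t. ennreal (F t \<omega>)) \<longlongrightarrow> l) at_top \<longleftrightarrow> False" for l by (auto simp: iff)
      then show ?thesis using False unfolding limit_functional_def t2_space_class.Lim_def by simp
    qed
  qed
  then show ?thesis
    by (subst measurable_cong) (assumption, measurable)
qed

lemma bounded_measurable_indicator:
  "A \<in> sets G \<Longrightarrow> bounded_measurable G (indicator A)"
  by (auto simp: bounded_measurable_def bounded_iff indicator_def intro!: exI[of _ 1])

section \<open>The event g \<le> t and the passage between Q and P\<close>

text \<open>The setting in which Q is compared with P. Right-continuity of \<open>X\<close> is what
  allows zeros to be detected along rational times.\<close>

locale last_zero_space =
  fixes P :: "'a measure" and \<F> :: "real \<Rightarrow> 'a measure" and X :: "real \<Rightarrow> 'a \<Rightarrow> real"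
    and Q :: "'a measure"
  assumes filtered: "filtered_prob_space P \<F>"
    and X_adapted: "adapted \<F> X"
    and X_integrable: "0 \<le> t \<Longrightarrow> integrable P (X t)"
    and X_nonneg: "0 \<le> t \<Longrightarrow> \<omega> \<in> space P \<Longrightarrow> 0 \<le> X t \<omega>"
    and X_right_continuous:
      "0 \<le> t \<Longrightarrow> \<omega> \<in> space P \<Longrightarrow> ((\<lambda>s. X s \<omega>) \<longlongrightarrow> X t \<omega>) (at_right t)"
    and associated: "associated_measure P \<F> X Q"
begin

text \<open>The event g \<le> t, as a subset of the whole type; measurability is therefore stated
  for its intersection with \<open>space Q\<close>.\<close>

abbreviation settled :: "real \<Rightarrow> 'a set" where
  "settled t \<equiv> {\<omega>. last_zero X \<omega> \<le> ennreal t}"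

lemma prob_space_P: "prob_space P"
  using filtered by (simp add: filtered_prob_space_def)

lemma space_Q: "space Q = space P" and sets_Q [measurable_cong]: "sets Q = sets P"
  using associated by (auto simp: associated_measure_def)

lemma space_filtration: "0 \<le> t \<Longrightarrow> space (\<F> t) = space P"
  using filtered
  by (auto simp: filtered_prob_space_def filtered_measurable_space_def subalgebra_def)

lemma sets_filtration: "0 \<le> t \<Longrightarrow> sets (\<F> t) \<subseteq> sets P"
  using filtered
  by (auto simp: filtered_prob_space_def filtered_measurable_space_def subalgebra_def)

lemma filtration_mono: "0 \<le> s \<Longrightarrow> s \<le> t \<Longrightarrow> sets (\<F> s) \<subseteq> sets (\<F> t)"
  using filtered
  by (auto simp: filtered_prob_space_def filtered_measurable_space_def subalgebra_def)

lemma measurable_from_filtration: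
  "0 \<le> t \<Longrightarrow> f \<in> measurable (\<F> t) N \<Longrightarrow> f \<in> measurable P N"
  using measurable_mono[of N N "\<F> t" P] sets_filtration[of t] space_filtration[of t]
  by auto

lemma measurable_filtration_mono:
  "0 \<le> s \<Longrightarrow> s \<le> t \<Longrightarrow> f \<in> measurable (\<F> s) N \<Longrightarrow> f \<in> measurable (\<F> t) N"
  using measurable_mono[of N N "\<F> s" "\<F> t"] filtration_mono[of s t]
    space_filtration[of s] space_filtration[of t]
  by auto

lemma X_measurable_filtration: "0 \<le> s \<Longrightarrow> s \<le> t \<Longrightarrow> X s \<in> borel_measurable (\<F> t)"
  using X_adapted measurable_filtration_mono[of s t "X s"] by (simp add: adapted_def)

lemma last_zero_finite: "AE \<omega> in Q. last_zero X \<omega> < \<infinity>"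
proof -
  have "{\<omega>\<in>space Q. last_zero X \<omega> = \<infinity>} \<in> null_sets Q"
    using associated unfolding associated_measure_def by blast
  then show ?thesis
    by (rule AE_I') (auto simp: not_less top_unique)
qed

lemma has_bochner_integral_settled:
  assumes "0 \<le> t" "bounded_measurable (\<F> t) f"
  shows "has_bochner_integral Q (\<lambda>\<omega>. f \<omega> * indicator (settled t) \<omega>) (\<integral>\<omega>. f \<omega> * X t \<omega> \<partial>P)"
  using associated assms unfolding associated_measure_def by blast

text \<open>Testing the characterisation of Q with the constant 1 suffices: the existence of a
  Bochner integral includes measurability of the integrand, here the indicator of g \<le> t.\<close>

lemma settled_sets: 
  assumes "0 \<le> t" shows "settled t \<inter> space Q \<in> sets Q"
proof -
  have "bounded_measurable (\<F> t) (indicator (space (\<F> t)))"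
    by (rule bounded_measurable_indicator) simp
  from has_bochner_integral_settled[OF assms this]
  have "(\<lambda>\<omega>. indicator (space (\<F> t)) \<omega> * indicator (settled t) \<omega> :: real) \<in> borel_measurable Q"
    by (auto simp: has_bochner_integral_iff)
  also have "?this \<longleftrightarrow> (indicator (settled t) :: _ \<Rightarrow> real) \<in> borel_measurable Q"
    by (intro measurable_cong) (simp add: space_filtration assms space_Q)
  finally show ?thesis
    by (simp add: borel_measurable_indicator_iff)
qed

lemma settled_measurable [measurable]:
  assumes "0 \<le> t"
  shows "(indicator (settled t) :: 'a \<Rightarrow> ennreal) \<in> borel_measurable Q"
    and "(indicator (settled t) :: 'a \<Rightarrow> real) \<in> borel_measurable Q"
  using settled_sets[OF assms] by (simp_all add: borel_measurable_indicator_iff)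

text \<open>Extends the characterisation of Q from bounded to arbitrary nonnegative extended
  functions. The measures with density 1(g \<le> t) for Q and \<open>X t\<close> for P agree on
  \<open>\<F> t\<close>, and the integral of an \<open>\<F> t\<close>-measurable function only sees
  the restriction to \<open>\<F> t\<close>.\<close>

lemma nn_integral_settled:
  assumes t: "0 \<le> t" and f: "f \<in> borel_measurable (\<F> t)"
  shows "(\<integral>\<^sup>+\<omega>. f \<omega> * indicator (settled t) \<omega> \<partial>Q) = (\<integral>\<^sup>+\<omega>. f \<omega> * ennreal (X t \<omega>) \<partial>P)"
proof -
  let ?DQ = "density Q (indicator (settled t))" and ?DP = "density P (\<lambda>\<omega>. ennreal (X t \<omega>))"
  let ?R = "restr_to_subalg ?DQ (\<F> t)"
  have fP [measurable]: "f \<in> borel_measurable P"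
    by (rule measurable_from_filtration[OF t f])
  have X [measurable]: "X t \<in> borel_measurable P"
    using X_integrable[OF t] by auto
  have sub: "subalgebra ?DQ (\<F> t)"
    by (simp add: subalgebra_def space_filtration[OF t] space_Q sets_Q sets_filtration[OF t])
  have eq: "emeasure ?DQ B = emeasure ?DP B" if B: "B \<in> sets (\<F> t)" for B
  proof -
    have [measurable]: "B \<in> sets P" using B sets_filtration[OF t] by blast
    have [measurable]: "B \<in> sets Q" by (simp add: sets_Q)
    note bm = has_bochner_integral_settled[OF t bounded_measurable_indicator[OF B]]
    have "emeasure ?DQ B = (\<integral>\<^sup>+\<omega>. ennreal (indicator B \<omega> * indicator (settled t) \<omega>) \<partial>Q)"
      using t by (subst emeasure_density) (auto intro!: nn_integral_cong split: split_indicator)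
    also have "\<dots> = ennreal (\<integral>\<omega>. indicator B \<omega> * X t \<omega> \<partial>P)"
      using bm by (subst nn_integral_eq_integral) (auto simp: has_bochner_integral_iff)
    also have "\<dots> = (\<integral>\<^sup>+\<omega>. ennreal (indicator B \<omega> * X t \<omega>) \<partial>P)"
      by (subst nn_integral_eq_integral)
        (auto intro!: integrable_real_mult_indicator X_integrable AE_I2 mult_nonneg_nonneg X_nonneg t
              simp: mult.commute[of "indicator B _"])
    also have "\<dots> = emeasure ?DP B"
      by (subst emeasure_density) (auto intro!: nn_integral_cong split: split_indicator)
    finally show ?thesis .
  qed
  have fR: "f \<in> borel_measurable ?R"
    using f by (simp add: sets_restr_to_subalg[OF sub] cong: measurable_cong_sets)
  have sR: "sets ?R = sets (\<F> t)" "space ?R = space P"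
    by (auto simp: sets_restr_to_subalg[OF sub] space_restr_to_subalg space_Q)
  have "(\<integral>\<^sup>+\<omega>. f \<omega> * indicator (settled t) \<omega> \<partial>Q) = integral\<^sup>N ?DQ f"
    using t by (subst nn_integral_density) (auto simp: mult.commute)
  also have "\<dots> = integral\<^sup>N ?R f"
    by (rule nn_integral_subalgebra[symmetric, OF fR])
      (use sR sets_filtration[OF t] in \<open>auto simp: sets_Q space_Q emeasure_restr_to_subalg[OF sub]\<close>)
  also have "\<dots> = integral\<^sup>N ?DP f"
    by (rule nn_integral_subalgebra[OF fR])
      (use sR sets_filtration[OF t] in \<open>auto simp: emeasure_restr_to_subalg[OF sub] eq\<close>)
  also have "\<dots> = (\<integral>\<^sup>+\<omega>. f \<omega> * ennreal (X t \<omega>) \<partial>P)"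
    by (subst nn_integral_density) (auto simp: mult.commute)
  finally show ?thesis .
qed

lemma emeasure_settled:
  assumes t: "0 \<le> t" and B: "B \<in> sets (\<F> t)"
  shows "emeasure Q (B \<inter> settled t) = (\<integral>\<^sup>+\<omega>. indicator B \<omega> * ennreal (X t \<omega>) \<partial>P)"
proof -
  have "B \<in> sets Q" using B sets_filtration[OF t] by (auto simp: sets_Q)
  moreover from this have "B \<inter> settled t = B \<inter> (settled t \<inter> space Q)"
    using sets.sets_into_space by blast
  ultimately have *: "B \<inter> settled t \<in> sets Q"
    using settled_sets[OF t] by auto
  show ?thesis
    by (subst nn_integral_settled[OF t, symmetric])
      (use B * in \<open>auto simp: indicator_inter_arith[symmetric]\<close>)
qed

section \<open>Positivity of X after its last zero\<close>

text \<open>A maximal inequality under Q. Split by the first \<open>q\<close> in \<open>S\<close>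
  with \<open>X q\<close> below \<epsilon>. Since s \<le> q, the event g \<le> s lies in g \<le> q,
  where Q-mass is a P-integral of \<open>X q\<close>, hence at most \<epsilon> times a
  P-probability; the probabilities of disjoint events sum to at most 1.\<close>

lemma emeasure_settled_small_finite:
  assumes "finite S" "S \<subseteq> {s..}" "0 \<le> s" "0 < \<epsilon>"
  shows "emeasure Q {\<omega>\<in>space Q. \<omega> \<in> settled s \<and> (\<exists>q\<in>S. X q \<omega> < \<epsilon>)} \<le> ennreal \<epsilon>"
proof -
  interpret prob_space P by (rule prob_space_P)
  \<comment> \<open>\<open>E q\<close> says that \<open>q\<close> is the first time in
    \<open>S\<close> at which \<open>X\<close> is below \<epsilon>: it is decided by time
    \<open>q\<close>, and distinct times give disjoint events.\<close>
  define E where "E q = {\<omega>\<in>space P. X q \<omega> < \<epsilon> \<and> (\<forall>r\<in>S. r < q \<longrightarrow> \<epsilon> \<le> X r \<omega>)}" for q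
  have S0: "0 \<le> q" "s \<le> q" if "q \<in> S" for q using that assms by auto
  have E: "E q \<in> sets (\<F> q)" if "q \<in> S" for q
  proof -
    have "E q = {\<omega>\<in>space (\<F> q). X q \<omega> < \<epsilon> \<and> (\<forall>r\<in>{r\<in>S. r < q}. \<epsilon> \<le> X r \<omega>)}"
      unfolding E_def space_filtration[OF S0(1)[OF that]] by auto
    also have "\<dots> \<in> sets (\<F> q)"
    proof (intro sets.sets_Collect_conj sets.sets_Collect_countable_All')
      have [measurable]: "X q \<in> borel_measurable (\<F> q)"
        by (rule X_measurable_filtration) (use S0 that in auto)
      show "{\<omega>\<in>space (\<F> q). X q \<omega> < \<epsilon>} \<in> sets (\<F> q)" by measurable
    next
      fix r assume r: "r \<in> {r\<in>S. r < q}"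
      have [measurable]: "X r \<in> borel_measurable (\<F> q)"
        by (rule X_measurable_filtration) (use S0 r in auto)
      show "{\<omega>\<in>space (\<F> q). \<epsilon> \<le> X r \<omega>} \<in> sets (\<F> q)" by measurable
    qed (use assms in \<open>auto intro: countable_finite\<close>)
    finally show ?thesis .
  qed
  have EP: "E q \<in> sets P" if "q \<in> S" for q
    using E[OF that] sets_filtration[OF S0(1)[OF that]] by blast
  have bound: "emeasure Q (E q \<inter> settled q) \<le> ennreal \<epsilon> * emeasure P (E q)" if q: "q \<in> S" for q
  proof -
    have "emeasure Q (E q \<inter> settled q) = (\<integral>\<^sup>+\<omega>. indicator (E q) \<omega> * ennreal (X q \<omega>) \<partial>P)"
      by (rule emeasure_settled[OF S0(1)[OF q] E[OF q]])
    also have "\<dots> \<le> (\<integral>\<^sup>+\<omega>. ennreal \<epsilon> * indicator (E q) \<omega> \<partial>P)"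
      by (intro nn_integral_mono) (auto simp: E_def intro!: ennreal_leI split: split_indicator)
    also have "\<dots> = ennreal \<epsilon> * emeasure P (E q)"
      using EP[OF q] by (simp add: nn_integral_cmult_indicator)
    finally show ?thesis .
  qed
  have Es: "E q \<inter> settled q \<in> sets Q" if "q \<in> S" for q
  proof -
    have "E q \<inter> settled q = E q \<inter> (settled q \<inter> space Q)"
      using EP[OF that] sets.sets_into_space by (auto simp: space_Q)
    then show ?thesis using EP[OF that] settled_sets[OF S0(1)[OF that]] by (auto simp: sets_Q)
  qed
  have sub: "{\<omega>\<in>space Q. \<omega> \<in> settled s \<and> (\<exists>q\<in>S. X q \<omega> < \<epsilon>)} \<subseteq> (\<Union>q\<in>S. E q \<inter> settled q)"
  proof
    fix \<omega> assume "\<omega> \<in> {\<omega>\<in>space Q. \<omega> \<in> settled s \<and> (\<exists>q\<in>S. X q \<omega> < \<epsilon>)}"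
    then have \<omega>: "\<omega> \<in> space Q" "\<omega> \<in> settled s" "\<exists>q\<in>S. X q \<omega> < \<epsilon>" by auto
    define q where "q = Min {q\<in>S. X q \<omega> < \<epsilon>}"
    have "q \<in> {q\<in>S. X q \<omega> < \<epsilon>}"
      unfolding q_def by (rule Min_in) (use assms \<omega> in auto)
    moreover have "\<epsilon> \<le> X r \<omega>" if "r \<in> S" "r < q" for r
    proof (rule ccontr)
      assume "\<not> \<epsilon> \<le> X r \<omega>"
      then have "q \<le> r" unfolding q_def using that assms by (intro Min_le) auto
      with that show False by simp
    qed
    moreover have "\<omega> \<in> settled q"
    proof -
      have "ennreal s \<le> ennreal q" using calculation S0 by (intro ennreal_leI) auto
      then show ?thesis using \<omega>(2) by (auto intro: order_trans)
    qed
    ultimately show "\<omega> \<in> (\<Union>q\<in>S. E q \<inter> settled q)"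
      using \<omega>(1) by (auto simp: E_def space_Q)
  qed
  have "emeasure Q {\<omega>\<in>space Q. \<omega> \<in> settled s \<and> (\<exists>q\<in>S. X q \<omega> < \<epsilon>)}
      \<le> emeasure Q (\<Union>q\<in>S. E q \<inter> settled q)"
    by (rule emeasure_mono[OF sub]) (use assms Es in auto)
  also have "\<dots> \<le> (\<Sum>q\<in>S. emeasure Q (E q \<inter> settled q))"
    by (rule emeasure_subadditive_finite) (use assms Es in auto)
  also have "\<dots> \<le> (\<Sum>q\<in>S. ennreal \<epsilon> * emeasure P (E q))"
    by (intro sum_mono bound)
  also have "\<dots> = ennreal \<epsilon> * emeasure P (\<Union>q\<in>S. E q)"
  proof -
    have "disjoint_family_on E S"
      unfolding disjoint_family_on_def
    proof (intro ballI impI)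
      fix p q assume "p \<in> S" "q \<in> S" "p \<noteq> q"
      then show "E p \<inter> E q = {}"
        by (cases p q rule: linorder_cases) (force simp: E_def)+
    qed
    then have "(\<Sum>q\<in>S. emeasure P (E q)) = emeasure P (\<Union>q\<in>S. E q)"
      using assms EP by (intro sum_emeasure) auto
    then show ?thesis by (simp add: sum_distrib_left[symmetric])
  qed
  also have "\<dots> \<le> ennreal \<epsilon> * 1"
    by (intro mult_left_mono) (auto intro: emeasure_le_1)
  finally show ?thesis by simp
qed

text \<open>The finite bound does not depend on the number of times, so it passes to a countable
  \<open>S\<close> by exhaustion with finite subsets. Letting \<epsilon> tend to 0 leaves only a
  Q-null set of bad paths.\<close>

lemma settled_bounded_away_from_zero:
  assumes S: "countable S" "S \<subseteq> {s..}" and s: "0 \<le> s"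
  shows "AE \<omega> in Q. \<omega> \<in> settled s \<longrightarrow> (\<exists>j. \<forall>q\<in>S. inverse (real (Suc j)) \<le> X q \<omega>)"
proof (cases "S = {}")
  case False
  define W where "W T \<epsilon> = {\<omega>\<in>space Q. \<omega> \<in> settled s \<and> (\<exists>q\<in>T. X q \<omega> < \<epsilon>)}" for T \<epsilon>
  have W [measurable]: "W T \<epsilon> \<in> sets Q" if "T \<subseteq> S" for T \<epsilon>
  proof -
    have "W T \<epsilon> = (settled s \<inter> space Q) \<inter> (\<Union>q\<in>T. {\<omega>\<in>space P. X q \<omega> < \<epsilon>})"
      by (auto simp: W_def space_Q)
    also have "\<dots> \<in> sets Q"
    proof (rule sets.Int[OF settled_sets[OF s] sets.countable_UN''])
      show "countable T" using S(1) that countable_subset by blast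
      fix q assume "q \<in> T"
      then have [measurable]: "X q \<in> borel_measurable P"
        using X_integrable[of q] S s that by auto
      show "{\<omega>\<in>space P. X q \<omega> < \<epsilon>} \<in> sets Q" unfolding sets_Q by measurable
    qed
    finally show ?thesis .
  qed
  have W_le: "emeasure Q (W S \<epsilon>) \<le> ennreal \<epsilon>" if \<epsilon>: "0 < \<epsilon>" for \<epsilon>
  proof -
    define T where "T k = from_nat_into S ` {..<k}" for k :: nat
    have T: "T k \<subseteq> S" "finite (T k)" for k
      using from_nat_into[OF False] by (auto simp: T_def)
    have "S = (\<Union>k. T k)"
    proof
      show "S \<subseteq> (\<Union>k. T k)"
        using from_nat_into_surj[OF S(1)] unfolding T_def by (force intro: lessI)
    qed (use T in auto)
    then have "W S \<epsilon> = (\<Union>k. W (T k) \<epsilon>)" by (auto simp: W_def)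
    also have "emeasure Q \<dots> = (SUP k. emeasure Q (W (T k) \<epsilon>))"
    proof (rule SUP_emeasure_incseq[symmetric])
      show "incseq (\<lambda>k. W (T k) \<epsilon>)"
      proof (rule incseq_SucI)
        have "T k \<subseteq> T (Suc k)" for k by (auto simp: T_def)
        then show "W (T k) \<epsilon> \<subseteq> W (T (Suc k)) \<epsilon>" for k unfolding W_def by blast
      qed
    qed (use W T in auto)
    also have "\<dots> \<le> ennreal \<epsilon>"
    proof (rule SUP_least)
      show "emeasure Q (W (T k) \<epsilon>) \<le> ennreal \<epsilon>" for k
        unfolding W_def by (rule emeasure_settled_small_finite) (use T S s \<epsilon> in blast)+
    qed
    finally show ?thesis .
  qed
  \<comment> \<open>\<open>Z\<close> collects the paths with g \<le> s along which \<open>X\<close>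
    has infimum 0 over \<open>S\<close>.\<close>
  define Z where "Z = (\<Inter>j. W S (inverse (real (Suc j))))"
  have "emeasure Q Z \<le> ennreal (inverse (real (Suc j)))" for j
  proof -
    have "emeasure Q Z \<le> emeasure Q (W S (inverse (real (Suc j))))"
      unfolding Z_def by (rule emeasure_mono) (auto intro: W)
    also have "\<dots> \<le> ennreal (inverse (real (Suc j)))" by (rule W_le) simp
    finally show ?thesis .
  qed
  moreover have "(\<lambda>j. ennreal (inverse (real (Suc j)))) \<longlonglongrightarrow> ennreal 0"
    by (intro tendsto_ennrealI LIMSEQ_inverse_real_of_nat)
  ultimately have "emeasure Q Z \<le> ennreal 0"
    by (intro tendsto_lowerbound[where F=sequentially]) auto
  then have "Z \<in> null_sets Q"
    using W by (auto simp: Z_def intro!: null_setsI)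
  then show ?thesis
    by (rule AE_I') (auto simp: Z_def W_def not_le)
qed simp

text \<open>The witness scans \<open>X\<close> at \<open>t\<close> and at the rational times between \<open>s\<close> and \<open>t\<close>. This could mistake
  a vanishing left limit for a zero, but by the previous lemma only on a \<open>Q\<close>-null set.\<close>

lemma settled_decided_later:
  assumes s: "0 \<le> s" and st: "s \<le> t"
  shows "\<exists>B\<in>sets (\<F> t). AE \<omega> in Q. \<omega> \<in> settled s \<longleftrightarrow> \<omega> \<in> B \<and> \<omega> \<in> settled t"
proof -
  \<comment> \<open>The time \<open>t\<close> is added because right-continuity reveals a zero only
    through later times, and \<open>S\<close> has none after \<open>t\<close>.\<close>
  define S where "S = insert t (\<rat> \<inter> {s<..<t})"
  \<comment> \<open>A uniform lower bound is required, not mere positivity on \<open>S\<close>: a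
    zero at an irrational time shows up only as small values at rational times just after
    it.\<close>
  define B where "B = {\<omega>\<in>space P. \<exists>j. \<forall>q\<in>S. inverse (real (Suc j)) \<le> X q \<omega>}"
  have t: "0 \<le> t" using s st by simp
  have S: "countable S" "S \<subseteq> {s..}" "S \<subseteq> {0..t}"
    using s st countable_rat by (auto simp: S_def)
  have "B = {\<omega>\<in>space (\<F> t). \<exists>j. \<forall>q\<in>S. inverse (real (Suc j)) \<le> X q \<omega>}"
    by (simp add: B_def space_filtration[OF t])
  also have "\<dots> \<in> sets (\<F> t)"
  proof (intro sets.sets_Collect_countable_Ex sets.sets_Collect_countable_All' S)
    fix q and j :: nat assume "q \<in> S"
    then have [measurable]: "X q \<in> borel_measurable (\<F> t)"
      using S(3) by (intro X_measurable_filtration) auto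
    show "{\<omega>\<in>space (\<F> t). inverse (real (Suc j)) \<le> X q \<omega>} \<in> sets (\<F> t)" by measurable
  qed
  finally have B: "B \<in> sets (\<F> t)" .
  \<comment> \<open>This inclusion holds for every path: a zero in (s, t) pushes \<open>X\<close>
    below any positive bound at some time in \<open>S\<close>, and a zero at \<open>t\<close> does
    so at \<open>t\<close> itself.\<close>
  have BS: "\<omega> \<in> settled s" if \<omega>: "\<omega> \<in> B" "\<omega> \<in> settled t" for \<omega>
  proof (rule ccontr)
    assume "\<omega> \<notin> settled s"
    then have "ennreal s < last_zero X \<omega>" by auto
    then obtain r where r: "0 \<le> r" "X r \<omega> = 0" "ennreal s < ennreal r"
      by (auto simp: last_zero_def less_SUP_iff)
    have sr: "s < r" using r s by (simp add: ennreal_less_iff)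
    have "ennreal r \<le> last_zero X \<omega>" using r unfolding last_zero_def by (intro SUP_upper) auto
    also have "\<dots> \<le> ennreal t" using \<omega> by simp
    finally have rt: "r \<le> t" using t by (simp add: ennreal_le_iff)
    obtain j where j: "\<And>q. q \<in> S \<Longrightarrow> inverse (real (Suc j)) \<le> X q \<omega>" and \<omega>P: "\<omega> \<in> space P"
      using \<omega>(1) by (auto simp: B_def)
    have "r \<noteq> t" using j[of t] r by (auto simp: S_def)
    with rt have rt: "r < t" by simp
    have "\<forall>\<^sub>F q in at_right r. X q \<omega> < inverse (real (Suc j))"
      using X_right_continuous[OF r(1) \<omega>P] by (rule order_tendstoD) (simp add: r)
    then obtain b where b: "r < b" "\<And>q. r < q \<Longrightarrow> q < b \<Longrightarrow> X q \<omega> < inverse (real (Suc j))"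
      by (auto simp: eventually_at_right_field)
    obtain q where "q \<in> \<rat>" "r < q" "q < min b t"
      using Rats_dense_in_real[of r "min b t"] b(1) rt by auto
    with b(2)[of q] j[of q] sr show False by (auto simp: S_def)
  qed
  \<comment> \<open>The converse inclusion is where the Q-null set enters.\<close>
  have "AE \<omega> in Q. \<omega> \<in> settled s \<longrightarrow> (\<exists>j. \<forall>q\<in>S. inverse (real (Suc j)) \<le> X q \<omega>)"
    by (rule settled_bounded_away_from_zero[OF S(1,2) s])
  then have "AE \<omega> in Q. \<omega> \<in> settled s \<longleftrightarrow> \<omega> \<in> B \<and> \<omega> \<in> settled t"
    using AE_space
  proof eventually_elim
    case (elim \<omega>)
    have "ennreal s \<le> ennreal t" using st by (rule ennreal_leI)
    with elim BS[of \<omega>] show ?case by (auto simp: B_def space_Q intro: order_trans)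
  qed
  with B show ?thesis by blast
qed


section \<open>Uniform integrability from the dominating martingale\<close>

lemma settled_integrable: "0 \<le> t \<Longrightarrow> integrable Q (indicator (settled t) :: 'a \<Rightarrow> real)"
proof -
  assume t: "0 \<le> t"
  have "integrable Q (\<lambda>\<omega>. indicator (space (\<F> t)) \<omega> * indicator (settled t) \<omega> :: real)"
    using has_bochner_integral_settled[OF t bounded_measurable_indicator[OF sets.top]]
    by (simp add: has_bochner_integral_iff)
  also have "?this \<longleftrightarrow> ?thesis"
    by (intro Bochner_Integration.integrable_cong) (simp_all add: space_filtration[OF t] space_Q)
  finally show ?thesis .
qed

text \<open>Inside g \<le> t the event g \<le> s is replaced by \<open>B\<close>, which lies in
  \<open>\<F> t\<close>. The left side becomes the P-integral of \<open>X t\<close> times the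
  positive part of \<open>Y - c 1_B\<close>; domination replaces \<open>Y X\<close> by
  \<open>M\<close>, and the positive part of \<open>M - c 1_B X\<close> is carried back to Q, where
  \<open>M t\<close> turns into \<open>H\<close>.\<close>

lemma excess_le:
  fixes c s t :: real and H Y :: "'a \<Rightarrow> real"
  assumes s: "0 \<le> s" and st: "s \<le> t" and c: "0 \<le> c"
    and H: "integrable Q H" and M: "associated_martingale P \<F> Q H M"
    and Y: "Y \<in> borel_measurable (\<F> t)"
    and dom: "AE \<omega> in P. Y \<omega> * X t \<omega> \<le> M t \<omega>"
  shows "(\<integral>\<^sup>+\<omega>. ennreal (Y \<omega>) * indicator (settled t) \<omega> - ennreal c * indicator (settled s) \<omega> \<partial>Q)
    \<le> (\<integral>\<^sup>+\<omega>. ennreal (H \<omega> - c * indicator (settled s) \<omega>) \<partial>Q)"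
proof -
  have t: "0 \<le> t" using s st by simp
  obtain B where B: "B \<in> sets (\<F> t)"
    and B_eq: "AE \<omega> in Q. \<omega> \<in> settled s \<longleftrightarrow> \<omega> \<in> B \<and> \<omega> \<in> settled t"
    using settled_decided_later[OF s st] by blast
  note [measurable] = B Y X_measurable_filtration[OF t order_refl] settled_measurable[OF t]
    settled_measurable[OF s]
  have [measurable]: "M t \<in> borel_measurable (\<F> t)"
    using M t by (auto simp: associated_martingale_def martingale_def adapted_def)
  have M_int: "integrable P (M t)"
    using M t by (auto simp: associated_martingale_def martingale_def)
  \<comment> \<open>\<open>G\<close> is where \<open>M t - c 1_B X t\<close> is positive.
    Multiplying by its indicator takes the positive part, and \<open>G\<close> lies in
    \<open>\<F> t\<close>, so it is an admissible test event.\<close>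
  define G where "G = {\<omega>\<in>space (\<F> t). c * indicator B \<omega> * X t \<omega> < M t \<omega>}"
  have G [measurable]: "G \<in> sets (\<F> t)" unfolding G_def by measurable
  have GB: "G \<inter> B \<in> sets (\<F> t)" by measurable
  have GP [measurable]: "G \<in> sets P" "G \<inter> B \<in> sets P"
    using G GB sets_filtration[OF t] by auto
  have GQ [measurable]: "G \<in> sets Q" using GP by (simp add: sets_Q)
  have YB: "(\<lambda>\<omega>. ennreal (Y \<omega> - c * indicator B \<omega>)) \<in> borel_measurable (\<F> t)" by measurable
  have int_GM: "integrable P (\<lambda>\<omega>. indicator G \<omega> * M t \<omega>)"
    using integrable_real_mult_indicator[OF GP(1) M_int] by (simp add: mult.commute)
  have int_GBX: "integrable P (\<lambda>\<omega>. indicator (G \<inter> B) \<omega> * X t \<omega>)"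
    using integrable_real_mult_indicator[OF GP(2) X_integrable[OF t]] by (simp add: mult.commute)
  have int_HG: "integrable Q (\<lambda>\<omega>. H \<omega> * indicator G \<omega>)"
    by (rule integrable_real_mult_indicator[OF GQ H])
  note bochner = has_bochner_integral_settled[OF t bounded_measurable_indicator[OF GB]]
  have int_B: "integrable Q (\<lambda>\<omega>. indicator (G \<inter> B) \<omega> * indicator (settled t) \<omega> :: real)"
    using bochner by (rule integrable.intros)
  \<comment> \<open>The passage from P to Q: \<open>M t\<close> is tested with the indicator of
    \<open>G\<close> through the defining identity of the martingale, \<open>X t\<close> with that
    of \<open>G \<inter> B\<close> through the characterisation of Q.\<close>
  have real_eq: "(\<integral>\<omega>. indicator G \<omega> * M t \<omega> - c * (indicator (G \<inter> B) \<omega> * X t \<omega>) \<partial>P)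
      = (\<integral>\<omega>. H \<omega> * indicator G \<omega> - c * (indicator (G \<inter> B) \<omega> * indicator (settled t) \<omega>) \<partial>Q)"
  proof -
    have M_eq: "(\<integral>\<omega>. indicator G \<omega> * M t \<omega> \<partial>P) = (\<integral>\<omega>. H \<omega> * indicator G \<omega> \<partial>Q)"
      using M t bounded_measurable_indicator[OF G] unfolding associated_martingale_def by metis
    have X_eq: "(\<integral>\<omega>. indicator (G \<inter> B) \<omega> * indicator (settled t) \<omega> \<partial>Q)
        = (\<integral>\<omega>. indicator (G \<inter> B) \<omega> * X t \<omega> \<partial>P)"
      by (rule has_bochner_integral_integral_eq[OF bochner])
    show ?thesis
      by (simp only: Bochner_Integration.integral_diff[OF int_GM integrable_mult_right[OF int_GBX]]
          Bochner_Integration.integral_diff[OF int_HG integrable_mult_right[OF int_B]]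
          Bochner_Integration.integral_mult_right_zero M_eq X_eq)
  qed
  \<comment> \<open>Off g \<le> t both sides vanish, the left one by truncated subtraction; on g
    \<le> t the set \<open>B\<close> agrees with g \<le> s up to a Q-null set.\<close>
  have "(\<integral>\<^sup>+\<omega>. ennreal (Y \<omega>) * indicator (settled t) \<omega> - ennreal c * indicator (settled s) \<omega> \<partial>Q)
      = (\<integral>\<^sup>+\<omega>. ennreal (Y \<omega> - c * indicator B \<omega>) * indicator (settled t) \<omega> \<partial>Q)"
    using B_eq c
    by (intro nn_integral_cong_AE)
      (auto elim!: eventually_mono simp: ennreal_minus split: split_indicator)
  also have "\<dots> = (\<integral>\<^sup>+\<omega>. ennreal (Y \<omega> - c * indicator B \<omega>) * ennreal (X t \<omega>) \<partial>P)"
    by (rule nn_integral_settled[OF t YB])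
  also have "\<dots> \<le> (\<integral>\<^sup>+\<omega>. ennreal (indicator G \<omega> * M t \<omega> - c * (indicator (G \<inter> B) \<omega> * X t \<omega>)) \<partial>P)"
  proof (rule nn_integral_mono_AE, use dom AE_space in eventually_elim)
    case (elim \<omega>)
    have "ennreal (Y \<omega> - c * indicator B \<omega>) * ennreal (X t \<omega>)
        = ennreal (Y \<omega> * X t \<omega> - c * indicator B \<omega> * X t \<omega>)"
      using X_nonneg[OF t elim(2)] by (subst ennreal_mult''[symmetric]) (auto simp: left_diff_distrib)
    \<comment> \<open>On \<open>G\<close> this is the domination; off \<open>G\<close> it gives
      \<open>Y X - c 1_B X \<le> M - c 1_B X \<le> 0\<close>.\<close>
    also have "\<dots> \<le> ennreal (indicator G \<omega> * M t \<omega> - c * (indicator (G \<inter> B) \<omega> * X t \<omega>))"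
      using elim
      by (cases "\<omega> \<in> G")
        (auto simp: G_def space_filtration[OF t] ennreal_neg indicator_def intro!: ennreal_leI)
    finally show ?case .
  qed
  also have "\<dots> = ennreal (\<integral>\<omega>. indicator G \<omega> * M t \<omega> - c * (indicator (G \<inter> B) \<omega> * X t \<omega>) \<partial>P)"
  proof (rule nn_integral_eq_integral)
    show "AE \<omega> in P. 0 \<le> indicator G \<omega> * M t \<omega> - c * (indicator (G \<inter> B) \<omega> * X t \<omega>)"
    proof (rule AE_I2)
      fix \<omega>
      have "c * indicator B \<omega> * X t \<omega> < M t \<omega>" if "\<omega> \<in> G" using that by (simp add: G_def)
      then show "0 \<le> indicator G \<omega> * M t \<omega> - c * (indicator (G \<inter> B) \<omega> * X t \<omega>)"
        by (cases "\<omega> \<in> G"; cases "\<omega> \<in> B") simp_all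
    qed
  qed (intro Bochner_Integration.integrable_diff int_GM integrable_mult_right int_GBX)
  also have "\<dots> = ennreal (\<integral>\<omega>. H \<omega> * indicator G \<omega>
      - c * (indicator (G \<inter> B) \<omega> * indicator (settled t) \<omega>) \<partial>Q)"
    by (simp only: real_eq)
  \<comment> \<open>On \<open>G\<close> the integrand is Q-a.e. \<open>H - c 1(g \<le> s)\<close>,
    and off \<open>G\<close> it is 0; neither exceeds the positive part.\<close>
  also have "\<dots> \<le> ennreal (\<integral>\<omega>. max 0 (H \<omega> - c * indicator (settled s) \<omega>) \<partial>Q)"
  proof (intro ennreal_leI integral_mono_AE)
    show "AE \<omega> in Q. H \<omega> * indicator G \<omega> - c * (indicator (G \<inter> B) \<omega> * indicator (settled t) \<omega>)
        \<le> max 0 (H \<omega> - c * indicator (settled s) \<omega>)"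
      using B_eq by eventually_elim (auto split: split_indicator)
  qed (intro Bochner_Integration.integrable_diff integrable_max integrable_mult_right
      integrable_zero int_HG int_B H settled_integrable[OF s])+
  also have "\<dots> = (\<integral>\<^sup>+\<omega>. ennreal (max 0 (H \<omega> - c * indicator (settled s) \<omega>)) \<partial>Q)"
    by (rule nn_integral_eq_integral[symmetric])
      (auto intro!: integrable_max integrable_mult_right H settled_integrable[OF s])
  also have "\<dots> = (\<integral>\<^sup>+\<omega>. ennreal (H \<omega> - c * indicator (settled s) \<omega>) \<partial>Q)"
    by (intro nn_integral_cong) (simp add: max_def ennreal_neg)
  finally show ?thesis .
qed

text \<open>The integrands are dominated by \<open>|H|\<close>, and g is finite Q-a.e., so each path
  is eventually covered by \<open>n 1(g \<le> n)\<close>.\<close>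

lemma excess_tendsto_0:
  assumes H: "integrable Q H"
  shows "(\<lambda>n. \<integral>\<^sup>+\<omega>. ennreal (H \<omega> - real n * indicator (settled (real n)) \<omega>) \<partial>Q) \<longlonglongrightarrow> 0"
proof -
  have "(\<lambda>n. \<integral>\<^sup>+\<omega>. ennreal (H \<omega> - real n * indicator (settled (real n)) \<omega>) \<partial>Q)
      \<longlonglongrightarrow> (\<integral>\<^sup>+\<omega>. 0 \<partial>Q)"
  proof (rule nn_integral_dominated_convergence[where w="\<lambda>\<omega>. ennreal (norm (H \<omega>))"])
    show "(\<lambda>\<omega>. ennreal (H \<omega> - real n * indicator (settled (real n)) \<omega>)) \<in> borel_measurable Q" for n
      using H settled_measurable(2)[of "real n"] by measurable
    show "AE \<omega> in Q. ennreal (H \<omega> - real n * indicator (settled (real n)) \<omega>) \<le> ennreal (norm (H \<omega>))" for n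
      by (intro AE_I2 ennreal_leI) (auto split: split_indicator)
    show "AE \<omega> in Q. (\<lambda>n. ennreal (H \<omega> - real n * indicator (settled (real n)) \<omega>)) \<longlonglongrightarrow> 0"
      using last_zero_finite
    proof eventually_elim
      case (elim \<omega>)
      then obtain g where g: "last_zero X \<omega> = ennreal g" by (cases "last_zero X \<omega>") auto
      \<comment> \<open>One threshold serves twice: n \<ge> g switches the indicator on, and n \<ge>
        H then makes the truncated difference 0.\<close>
      have "\<forall>\<^sub>F n in sequentially. max g (H \<omega>) \<le> real n"
        using filterlim_real_sequentially unfolding filterlim_at_top by (rule spec)
      then have "\<forall>\<^sub>F n in sequentially. ennreal (H \<omega> - real n * indicator (settled (real n)) \<omega>) = 0"
        by eventually_elim (auto simp: g ennreal_neg ennreal_leI indicator_def)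
      then show ?case by (rule tendsto_eventually)
    qed
  qed (use H in \<open>auto simp: integrable_iff_bounded\<close>)
  then show ?thesis by simp
qed

section \<open>Convergence on events of the filtration\<close>

text \<open>Almost dominated convergence is applied along an arbitrary sequence of times
  \<open>T i\<close> tending to infinity, with integrands
  \<open>F 1_\<Lambda> 1(g \<le> T i)\<close> and levels \<open>n 1(g \<le> n)\<close>. Times are
  first kept above \<open>s\<close>, so that \<Lambda> belongs to every
  \<open>\<F> (T i)\<close>.\<close>

lemma penalised_convergence:
  assumes F_cadlag: "cadlag_process P F"
    and F_adapted: "adapted \<F> F"
    and F_nonneg: "\<And>t \<omega>. 0 \<le> t \<Longrightarrow> \<omega> \<in> space P \<Longrightarrow> 0 \<le> F t \<omega>"
    and F_limit: "AE \<omega> in Q. \<exists>l. ((\<lambda>t. ennreal (F t \<omega>)) \<longlongrightarrow> l) at_top"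
    and H: "integrable Q H" and M: "associated_martingale P \<F> Q H M"
    and dom: "\<And>t. 0 \<le> t \<Longrightarrow> AE \<omega> in P. F t \<omega> * X t \<omega> \<le> M t \<omega>"
    and s: "0 \<le> s" and \<Lambda>: "\<Lambda> \<in> sets (\<F> s)"
  shows "(\<integral>\<^sup>+\<omega>. limit_functional F \<omega> * indicator \<Lambda> \<omega> \<partial>Q) < \<infinity>"
    and "((\<lambda>t. \<integral>\<^sup>+\<omega>. ennreal (F t \<omega> * X t \<omega>) * indicator \<Lambda> \<omega> \<partial>P)
      \<longlongrightarrow> (\<integral>\<^sup>+\<omega>. limit_functional F \<omega> * indicator \<Lambda> \<omega> \<partial>Q)) at_top"
proof -
  have F_meas: "F t \<in> borel_measurable (\<F> t)" if "0 \<le> t" for t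
    using F_adapted that by (simp add: adapted_def)
  have [measurable]: "limit_functional F \<in> borel_measurable Q"
  proof -
    have "limit_functional F \<in> borel_measurable P"
      by (rule limit_functional_measurable[OF F_cadlag])
        (use F_meas measurable_from_filtration in blast)
    then show ?thesis by (simp add: measurable_cong_sets[OF sets_Q refl])
  qed
  have [measurable]: "\<Lambda> \<in> sets Q"
    using \<Lambda> sets_filtration[OF s] by (auto simp: sets_Q)
  have main: "(\<integral>\<^sup>+\<omega>. limit_functional F \<omega> * indicator \<Lambda> \<omega> \<partial>Q) < \<infinity>
    \<and> (\<lambda>i. \<integral>\<^sup>+\<omega>. ennreal (F (T i) \<omega> * X (T i) \<omega>) * indicator \<Lambda> \<omega> \<partial>P)
      \<longlonglongrightarrow> (\<integral>\<^sup>+\<omega>. limit_functional F \<omega> * indicator \<Lambda> \<omega> \<partial>Q)"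
    if T: "filterlim T at_top sequentially" "\<And>i. s \<le> T i" for T :: "nat \<Rightarrow> real"
  proof -
    have T0: "0 \<le> T i" for i using T(2)[of i] s by simp
    define Y where "Y i \<omega> = F (T i) \<omega> * indicator \<Lambda> \<omega>" for i \<omega>
    have Y: "Y i \<in> borel_measurable (\<F> (T i))" for i
    proof -
      have [measurable]: "\<Lambda> \<in> sets (\<F> (T i))" using \<Lambda> filtration_mono[OF s T(2)[of i]] by blast
      show ?thesis unfolding Y_def using F_meas[OF T0[of i]] by measurable
    qed
    have YQ [measurable]: "Y i \<in> borel_measurable Q" for i
      using measurable_from_filtration[OF T0 Y] by (simp add: measurable_cong_sets[OF sets_Q refl])
    let ?u = "\<lambda>i \<omega>. ennreal (Y i \<omega>) * indicator (settled (T i)) \<omega>"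
    let ?K = "\<lambda>n \<omega>. ennreal (real n) * indicator (settled (real n)) \<omega>"
    have eq: "(\<integral>\<^sup>+\<omega>. ?u i \<omega> \<partial>Q)
        = (\<integral>\<^sup>+\<omega>. ennreal (F (T i) \<omega> * X (T i) \<omega>) * indicator \<Lambda> \<omega> \<partial>P)" for i
    proof -
      have "(\<integral>\<^sup>+\<omega>. ?u i \<omega> \<partial>Q) = (\<integral>\<^sup>+\<omega>. ennreal (Y i \<omega>) * ennreal (X (T i) \<omega>) \<partial>P)"
        by (rule nn_integral_settled[OF T0]) (use Y[of i] in measurable)
      also have "\<dots> = (\<integral>\<^sup>+\<omega>. ennreal (F (T i) \<omega> * X (T i) \<omega>) * indicator \<Lambda> \<omega> \<partial>P)"
        by (intro nn_integral_cong)
          (auto simp: Y_def ennreal_mult X_nonneg[OF T0] F_nonneg[OF T0] split: split_indicator)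
      finally show ?thesis .
    qed
    have "(\<integral>\<^sup>+\<omega>. limit_functional F \<omega> * indicator \<Lambda> \<omega> \<partial>Q) < \<infinity>
      \<and> (\<lambda>i. \<integral>\<^sup>+\<omega>. ?u i \<omega> \<partial>Q) \<longlonglongrightarrow> (\<integral>\<^sup>+\<omega>. limit_functional F \<omega> * indicator \<Lambda> \<omega> \<partial>Q)"
    \<comment> \<open>Finiteness and convergence rest on the same premises, so each premise is
      discharged once for either conjunct.\<close>
    proof (rule conjI; rule almost_dominated_convergence[where K = ?K
        and e = "\<lambda>n. \<integral>\<^sup>+\<omega>. ennreal (H \<omega> - real n * indicator (settled (real n)) \<omega>) \<partial>Q"])
      show "?u i \<in> borel_measurable Q" for i
        using settled_measurable(1)[OF T0[of i]] by measurable
      then show "?u i \<in> borel_measurable Q" for i .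
      show "?K n \<in> borel_measurable Q" for n
        using settled_measurable(1)[of "real n"] by measurable
      then show "?K n \<in> borel_measurable Q" for n .
      show "(\<integral>\<^sup>+\<omega>. ?K n \<omega> \<partial>Q) < \<infinity>" for n
        using settled_integrable[of "real n"] settled_measurable(1)[of "real n"]
        by (auto simp: nn_integral_cmult integrable_iff_bounded ennreal_indicator ennreal_mult_less_top)
      then show "(\<integral>\<^sup>+\<omega>. ?K n \<omega> \<partial>Q) < \<infinity>" for n .
      show "AE \<omega> in Q. (\<lambda>i. ?u i \<omega>) \<longlonglongrightarrow> limit_functional F \<omega> * indicator \<Lambda> \<omega>"
        using F_limit last_zero_finite
      proof eventually_elim
        case (elim \<omega>)
        then obtain l where l: "((\<lambda>t. ennreal (F t \<omega>)) \<longlongrightarrow> l) at_top" by blast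
        then have "limit_functional F \<omega> = l"
          unfolding limit_functional_def by (intro tendsto_Lim) auto
        with filterlim_compose[OF l T(1)]
        have lim: "(\<lambda>i. ennreal (F (T i) \<omega>)) \<longlonglongrightarrow> limit_functional F \<omega>" by simp
        obtain g where g: "last_zero X \<omega> = ennreal g" using elim by (cases "last_zero X \<omega>") auto
        \<comment> \<open>As g is finite, the indicator of g \<le> \<open>T i\<close> is eventually
          1 and does not affect the limit.\<close>
        have "\<forall>\<^sub>F i in sequentially. g \<le> T i" using T(1) by (auto simp: filterlim_at_top)
        then have "\<forall>\<^sub>F i in sequentially. ennreal (F (T i) \<omega>) * indicator \<Lambda> \<omega> = ?u i \<omega>"
          by eventually_elim (auto simp: g Y_def ennreal_leI split: split_indicator)
        moreover have "(\<lambda>i. ennreal (F (T i) \<omega>) * indicator \<Lambda> \<omega>)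
            \<longlonglongrightarrow> limit_functional F \<omega> * indicator \<Lambda> \<omega>"
          using lim by (auto split: split_indicator)
        ultimately show ?case by (rule Lim_transform_eventually[rotated])
      qed
      then show "AE \<omega> in Q. (\<lambda>i. ?u i \<omega>) \<longlonglongrightarrow> limit_functional F \<omega> * indicator \<Lambda> \<omega>" .
      show "\<forall>\<^sub>F i in sequentially. (\<integral>\<^sup>+\<omega>. ?u i \<omega> - ?K n \<omega> \<partial>Q)
          \<le> (\<integral>\<^sup>+\<omega>. ennreal (H \<omega> - real n * indicator (settled (real n)) \<omega>) \<partial>Q)" for n
      proof -
        have "\<forall>\<^sub>F i in sequentially. real n \<le> T i" using T(1) by (auto simp: filterlim_at_top)
        then show ?thesis
        proof eventually_elim
          case (elim i)
          \<comment> \<open>Localising to \<Lambda> preserves the domination: off \<Lambda> the left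
            side is 0, while \<open>M\<close> is at least the nonnegative
            \<open>F X\<close>.\<close>
          have "AE \<omega> in P. Y i \<omega> * X (T i) \<omega> \<le> M (T i) \<omega>"
            using dom[OF T0[of i]] AE_space
          proof eventually_elim
            case (elim \<omega>)
            then have "0 \<le> F (T i) \<omega> * X (T i) \<omega>"
              using F_nonneg[OF T0] X_nonneg[OF T0] by simp
            with elim show ?case by (auto simp: Y_def split: split_indicator)
          qed
          then show ?case
            by (intro excess_le[OF _ elim _ H M Y]) auto
        qed
      qed
      then show "\<forall>\<^sub>F i in sequentially. (\<integral>\<^sup>+\<omega>. ?u i \<omega> - ?K n \<omega> \<partial>Q)
          \<le> (\<integral>\<^sup>+\<omega>. ennreal (H \<omega> - real n * indicator (settled (real n)) \<omega>) \<partial>Q)" for n .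
    qed (use excess_tendsto_0[OF H] in auto)
    then show ?thesis by (simp add: eq)
  qed
  have "filterlim (\<lambda>i. s + real i) at_top sequentially"
    by (intro filterlim_tendsto_add_at_top[OF tendsto_const] filterlim_real_sequentially)
  from main[OF this] show "(\<integral>\<^sup>+\<omega>. limit_functional F \<omega> * indicator \<Lambda> \<omega> \<partial>Q) < \<infinity>" by simp
  show "((\<lambda>t. \<integral>\<^sup>+\<omega>. ennreal (F t \<omega> * X t \<omega>) * indicator \<Lambda> \<omega> \<partial>P)
      \<longlongrightarrow> (\<integral>\<^sup>+\<omega>. limit_functional F \<omega> * indicator \<Lambda> \<omega> \<partial>Q)) at_top"
  proof (rule tendsto_at_topI_sequentially)
    fix T :: "nat \<Rightarrow> real" assume T: "filterlim T at_top sequentially"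
    \<comment> \<open>A general sequence is raised to at least \<open>s\<close>, which changes only
      finitely many terms.\<close>
    then have ev: "\<forall>\<^sub>F i in sequentially. max s (T i) = T i"
      by (auto simp: filterlim_at_top max_absorb2 elim!: allE[of _ s] eventually_mono)
    have "filterlim (\<lambda>i. max s (T i)) at_top sequentially"
      by (rule filterlim_at_top_mono[OF T]) auto
    from conjunct2[OF main[OF this]]
    have "(\<lambda>i. \<integral>\<^sup>+\<omega>. ennreal (F (max s (T i)) \<omega> * X (max s (T i)) \<omega>) * indicator \<Lambda> \<omega> \<partial>P)
      \<longlonglongrightarrow> (\<integral>\<^sup>+\<omega>. limit_functional F \<omega> * indicator \<Lambda> \<omega> \<partial>Q)" by simp
    then show "(\<lambda>i. \<integral>\<^sup>+\<omega>. ennreal (F (T i) \<omega> * X (T i) \<omega>) * indicator \<Lambda> \<omega> \<partial>P)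
      \<longlonglongrightarrow> (\<integral>\<^sup>+\<omega>. limit_functional F \<omega> * indicator \<Lambda> \<omega> \<partial>Q)"
      by (rule Lim_transform_eventually) (use ev in eventually_elim, simp)
  qed
qed

end

section \<open>Normalisation and the limiting probability\<close>

theorem proposition3p10:
  fixes P :: "'a measure" and \<F> :: "real \<Rightarrow> 'a measure"
    and X N A :: "real \<Rightarrow> 'a \<Rightarrow> real" and Q :: "'a measure"
    and F :: "real \<Rightarrow> 'a \<Rightarrow> real" and H :: "'a \<Rightarrow> real" and M :: "real \<Rightarrow> 'a \<Rightarrow> real"
  assumes NP: "property_NP P \<F>"
    and Sigma: "class_Sigma P \<F> X N A"
    and Q: "associated_measure P \<F> X Q"
    and A_infinity: "AE \<omega> in P. filterlim (\<lambda>t. A t \<omega>) at_top at_top"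
    and F_cadlag: "cadlag_process P F"
    and F_adapted: "adapted \<F> F"
    and F_nonneg: "\<And>t \<omega>. 0 \<le> t \<Longrightarrow> \<omega> \<in> space P \<Longrightarrow> 0 \<le> F t \<omega>"
    and F_limit: "AE \<omega> in Q. \<exists>l. ((\<lambda>t. ennreal (F t \<omega>)) \<longlongrightarrow> l) at_top"
    and F_limit_nonzero: "\<not> (AE \<omega> in Q. limit_functional F \<omega> = 0)"
    and H_integrable: "integrable Q H"
    and H_nonneg: "\<And>\<omega>. \<omega> \<in> space Q \<Longrightarrow> 0 \<le> H \<omega>"
    and M: "associated_martingale P \<F> Q H M"
    and domination: "\<And>t. 0 \<le> t \<Longrightarrow> AE \<omega> in P. F t \<omega> * X t \<omega> \<le> M t \<omega>"
  shows "(\<forall>\<^sub>F t in at_top. 0 < (\<integral>\<^sup>+\<omega>. ennreal (F t \<omega> * X t \<omega>) \<partial>P) \<and>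
            (\<integral>\<^sup>+\<omega>. ennreal (F t \<omega> * X t \<omega>) \<partial>P) < \<infinity>) \<and>
    (let Qt = (\<lambda>t. density P (\<lambda>\<omega>. ennreal (F t \<omega> * X t \<omega>) /
                       (\<integral>\<^sup>+\<omega>'. ennreal (F t \<omega>' * X t \<omega>') \<partial>P)))
     in \<exists>Qinf. prob_space Qinf \<and> space Qinf = space P \<and> sets Qinf = sets P \<and>
          (\<forall>s\<ge>0. \<forall>\<Lambda>\<in>sets (\<F> s). ((\<lambda>t. emeasure (Qt t) \<Lambda>) \<longlongrightarrow> emeasure Qinf \<Lambda>) at_top) \<and>
          absolutely_continuous Q Qinf \<and>
          0 < (\<integral>\<^sup>+\<omega>. limit_functional F \<omega> \<partial>Q) \<and> (\<integral>\<^sup>+\<omega>. limit_functional F \<omega> \<partial>Q) < \<infinity> \<and>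
          Qinf = density Q (\<lambda>\<omega>. limit_functional F \<omega> / (\<integral>\<^sup>+\<omega>'. limit_functional F \<omega>' \<partial>Q)))"
proof -
  interpret last_zero_space P \<F> X Q
  proof
    show "filtered_prob_space P \<F>" using NP by (auto simp: property_NP_def natural_enlargement_def)
    show "adapted \<F> X" using Sigma by (simp add: class_Sigma_def submartingale_def)
    show "integrable P (X t)" if "0 \<le> t" for t
      using Sigma that by (simp add: class_Sigma_def submartingale_def)
    show "0 \<le> X t \<omega>" if "0 \<le> t" "\<omega> \<in> space P" for t \<omega>
      using Sigma that unfolding class_Sigma_def by blast
    \<comment> \<open>Right-continuity of \<open>X\<close> is inherited from the cadlag part
      \<open>N\<close> and the continuous part \<open>A\<close>.\<close>
    show "((\<lambda>r. X r \<omega>) \<longlongrightarrow> X t \<omega>) (at_right t)" if t: "0 \<le> t" and \<omega>: "\<omega> \<in> space P" for t \<omega>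
    proof -
      have X: "X r \<omega> = N r \<omega> + A r \<omega>" if "0 \<le> r" for r
        using Sigma that \<omega> by (simp add: class_Sigma_def)
      have N: "((\<lambda>r. N r \<omega>) \<longlongrightarrow> N t \<omega>) (at_right t)"
        using Sigma t \<omega> by (simp add: class_Sigma_def cadlag_process_def cadlag_def)
      have "continuous_on {0..} (\<lambda>r. A r \<omega>)" using Sigma \<omega> by (simp add: class_Sigma_def)
      then have "((\<lambda>r. A r \<omega>) \<longlongrightarrow> A t \<omega>) (at t within {0..})" using t by (simp add: continuous_on_def)
      then have "((\<lambda>r. A r \<omega>) \<longlongrightarrow> A t \<omega>) (at_right t)" by (rule tendsto_within_subset) (use t in auto)
      with N have "((\<lambda>r. N r \<omega> + A r \<omega>) \<longlongrightarrow> X t \<omega>) (at_right t)"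
        unfolding X[OF t] by (rule tendsto_add)
      then show ?thesis
        by (rule Lim_transform_eventually)
          (use t in \<open>auto simp: X eventually_at_filter intro!: eventually_mono[OF always_eventually]\<close>)
    qed
  qed (rule Q)
  have conv:
    "(\<integral>\<^sup>+\<omega>. limit_functional F \<omega> * indicator \<Lambda> \<omega> \<partial>Q) < \<infinity>"
    "((\<lambda>t. \<integral>\<^sup>+\<omega>. ennreal (F t \<omega> * X t \<omega>) * indicator \<Lambda> \<omega> \<partial>P)
      \<longlongrightarrow> (\<integral>\<^sup>+\<omega>. limit_functional F \<omega> * indicator \<Lambda> \<omega> \<partial>Q)) at_top"
    if "0 \<le> s" "\<Lambda> \<in> sets (\<F> s)" for s \<Lambda>
    by (rule penalised_convergence[OF F_cadlag F_adapted _ F_limit H_integrable M _ that];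
        fact F_nonneg domination)+
  let ?a = "\<lambda>t. \<integral>\<^sup>+\<omega>. ennreal (F t \<omega> * X t \<omega>) \<partial>P" and ?c = "\<integral>\<^sup>+\<omega>. limit_functional F \<omega> \<partial>Q"
  define Qinf where "Qinf = density Q (\<lambda>\<omega>. limit_functional F \<omega> / ?c)"
  have FP: "F t \<in> borel_measurable P" if "0 \<le> t" for t
    using F_adapted that by (intro measurable_from_filtration[OF that]) (simp add: adapted_def)
  have XP: "X t \<in> borel_measurable P" if "0 \<le> t" for t
    using X_integrable[OF that] by auto
  have [measurable]: "limit_functional F \<in> borel_measurable Q"
    using limit_functional_measurable[OF F_cadlag FP] by (simp add: measurable_cong_sets[OF sets_Q refl])
  \<comment> \<open>The whole space, an event of \<open>\<F> 0\<close>, yields convergence of the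
    normalising constants.\<close>
  have P0: "space P \<in> sets (\<F> 0)" by (metis order_refl sets.top space_filtration)
  have cP: "(\<integral>\<^sup>+\<omega>. limit_functional F \<omega> * indicator (space P) \<omega> \<partial>Q) = ?c"
    by (rule nn_integral_cong) (simp add: space_Q)
  have aP: "(\<integral>\<^sup>+\<omega>. ennreal (F t \<omega> * X t \<omega>) * indicator (space P) \<omega> \<partial>P) = ?a t" for t
    by (rule nn_integral_cong) simp
  have c_fin: "?c < \<infinity>" and a_lim: "(?a \<longlongrightarrow> ?c) at_top"
    using conv[OF order_refl P0] by (simp_all only: cP aP)
  have c_pos: "0 < ?c"
    using F_limit_nonzero by (simp add: zero_less_iff_neq_zero nn_integral_0_iff_AE)
  have emeasure_Qinf: "emeasure Qinf \<Lambda> = (\<integral>\<^sup>+\<omega>. limit_functional F \<omega> * indicator \<Lambda> \<omega> \<partial>Q) / ?c"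
    if "\<Lambda> \<in> sets P" for \<Lambda>
  proof -
    have [measurable]: "\<Lambda> \<in> sets Q" using that by (simp add: sets_Q)
    have "emeasure Qinf \<Lambda> = (\<integral>\<^sup>+\<omega>. limit_functional F \<omega> * indicator \<Lambda> \<omega> / ?c \<partial>Q)"
      unfolding Qinf_def by (subst emeasure_density) (auto simp: divide_ennreal_def mult_ac)
    also have "\<dots> = (\<integral>\<^sup>+\<omega>. limit_functional F \<omega> * indicator \<Lambda> \<omega> \<partial>Q) / ?c"
      by (rule nn_integral_divide) measurable
    finally show ?thesis .
  qed
  have "prob_space Qinf"
  proof
    have "emeasure Qinf (space Qinf) = emeasure Qinf (space P)" by (simp add: Qinf_def space_Q)
    also have "\<dots> = ?c / ?c" by (simp add: emeasure_Qinf cP)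
    also have "\<dots> = 1" using c_pos c_fin by (intro ennreal_divide_self) auto
    finally show "emeasure Qinf (space Qinf) = 1" .
  qed
  moreover have "absolutely_continuous Q Qinf"
    unfolding Qinf_def by (rule absolutely_continuousI_density) measurable
  moreover have "((\<lambda>t. emeasure (density P (\<lambda>\<omega>. ennreal (F t \<omega> * X t \<omega>) / ?a t)) \<Lambda>)
      \<longlongrightarrow> emeasure Qinf \<Lambda>) at_top" if s: "0 \<le> s" and \<Lambda>: "\<Lambda> \<in> sets (\<F> s)" for s \<Lambda>
  proof -
    have [measurable]: "\<Lambda> \<in> sets P" using \<Lambda> sets_filtration[OF s] by blast
    \<comment> \<open>Division is multiplication by the inverse, which is continuous on extended
      reals. As \<open>?c\<close> lies strictly between 0 and \<infinity> and the numerator has a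
      finite limit, the limiting product is never of the form 0 times \<infinity>.\<close>
    have "((\<lambda>t. inverse (?a t)) \<longlongrightarrow> inverse ?c) at_top"
      by (rule continuous_on_tendsto_compose[OF continuous_on_inverse_ennreal[OF continuous_on_id, of UNIV] a_lim]) auto
    then have "((\<lambda>t. (\<integral>\<^sup>+\<omega>. ennreal (F t \<omega> * X t \<omega>) * indicator \<Lambda> \<omega> \<partial>P) / ?a t)
        \<longlongrightarrow> emeasure Qinf \<Lambda>) at_top"
      unfolding emeasure_Qinf[OF \<open>\<Lambda> \<in> sets P\<close>] divide_ennreal_def
      by (intro tendsto_mult_ennreal conv(2)[OF s \<Lambda>])
        (use conv(1)[OF s \<Lambda>] c_pos c_fin in \<open>auto simp: ennreal_inverse_eq_top_iff ennreal_inverse_eq_0_iff\<close>)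
    then show ?thesis
    proof (rule Lim_transform_eventually)
      show "\<forall>\<^sub>F t in at_top. (\<integral>\<^sup>+\<omega>. ennreal (F t \<omega> * X t \<omega>) * indicator \<Lambda> \<omega> \<partial>P) / ?a t
          = emeasure (density P (\<lambda>\<omega>. ennreal (F t \<omega> * X t \<omega>) / ?a t)) \<Lambda>"
        using eventually_ge_at_top[of 0]
      proof eventually_elim
        case (elim t)
        note [measurable] = FP[OF elim] XP[OF elim]
        have "(\<integral>\<^sup>+\<omega>. ennreal (F t \<omega> * X t \<omega>) * indicator \<Lambda> \<omega> \<partial>P) / ?a t
            = (\<integral>\<^sup>+\<omega>. ennreal (F t \<omega> * X t \<omega>) * indicator \<Lambda> \<omega> / ?a t \<partial>P)"
          by (rule nn_integral_divide[symmetric]) measurable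
        also have "\<dots> = emeasure (density P (\<lambda>\<omega>. ennreal (F t \<omega> * X t \<omega>) / ?a t)) \<Lambda>"
          by (subst emeasure_density) (auto simp: divide_ennreal_def mult_ac)
        finally show ?case .
      qed
    qed
  qed
  \<comment> \<open>The normalising constants eventually enter the open interval (0, \<infinity>),
    because their limit \<open>?c\<close> lies in it.\<close>
  moreover have "\<forall>\<^sub>F t in at_top. 0 < ?a t \<and> ?a t < \<infinity>"
    using order_tendstoD(1)[OF a_lim c_pos] order_tendstoD(2)[OF a_lim c_fin] by eventually_elim simp
  moreover have "space Qinf = space P" "sets Qinf = sets P"
    by (simp_all add: Qinf_def space_Q sets_Q)
  ultimately show ?thesis
    unfolding Let_def using c_pos c_fin Qinf_def by blast
qed

end
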